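(* Fix $n,d\in\mathbb{N}$ with $d\in\{1,\ldots,n\}$ and let $(X,\|\cdot\|_X)$ be a complex Banach space. For every $p\in[1,\infty)$ and every function $f:\{-1,1\}^n\to X$ of degree at most $d$, we have $$\Big\|f-\frac{1}{2^n}\sum_{\delta\in\{-1,1\}^n}f(\delta)\Big\|_{L_p(\{-1,1\}^n;X)}\leq 3(\log d+1)\Big(\frac{1}{2^n}\sum_{\delta\in\{-1,1\}^n}\Big\|\sum_{i=1}^n\delta_i\partial_i f\Big\|_{L_p(\{-1,1\}^n;X)}^p\Big)^{1/p}$$ and the $\log d$ factor is asymptotically sharp for every $p\in[1,\infty)$.
   Context: $\mathbb{N}=\{1,2,\ldots\}$; $\log$ is the natural logarithm. For $p\in[1,\infty)$, $\|f\|_{L_p(\{-1,1\}^n;X)}=\big(2^{-n}\sum_{\varepsilon\in\{-1,1\}^n}\|f(\varepsilon)\|_X^p\big)^{1/p}$. For $A\subseteq\{1,\ldots,n\}$, the Walsh function is $w_A(\varepsilon)=\prod_{i\in A}\varepsilon_i$. Every $f:\{-1,1\}^n\to X$ has the expansion $f=\sum_{A\subseteq\{1,\ldots,n\}}\widehat f(A)w_A$ with $\widehat f(A)=2^{-n}\sum_{\delta\in\{-1,1\}^n}f(\delta)w_A(\delta)\in X$. A function $f$ has degree at most $d$ if $\widehat f(A)=0$ whenever $|A|>d$. The partial derivatives are $\partial_i f(\varepsilon)=\frac{f(\varepsilon)-f(\varepsilon_1,\ldots,\varepsilon_{i-1},-\varepsilon_i,\varepsilon_{i+1},\ldots,\varepsilon_n)}{2}=\sum_{A\ni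 i}\widehat f(A)w_A(\varepsilon)$. For fixed $\delta=(\delta_1,\ldots,\delta_n)\in\{-1,1\}^n$, $\sum_{i=1}^n\delta_i\partial_i f$ is regarded as a function of $\varepsilon\in\{-1,1\}^n$. *)

theory Defs
  imports "HOL-Analysis.Analysis"
begin

section \<open>Complex Banach spaces\<close>

text \<open>The distribution only has real Banach spaces. A complex Banach space is a
  real one together with a compatible multiplication by complex scalars for which the norm is
  homogeneous.\<close>

class complex_banach = banach +
  fixes scaleC :: "complex \<Rightarrow> 'a \<Rightarrow> 'a" (infixr \<open>*\<^sub>C\<close> 75)
  assumes scaleC_add_right: "a *\<^sub>C (x + y) = a *\<^sub>C x + a *\<^sub>C y"
    and scaleC_add_left: "(a + b) *\<^sub>C x = a *\<^sub>C x + b *\<^sub>C x"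
    and scaleC_scaleC: "a *\<^sub>C b *\<^sub>C x = (a * b) *\<^sub>C x"
    and scaleC_complex_of_real: "complex_of_real r *\<^sub>C x = r *\<^sub>R x"
    and norm_scaleC: "norm (a *\<^sub>C x) = cmod a * norm x"

instantiation complex :: complex_banach
begin

definition scaleC_complex :: "complex \<Rightarrow> complex \<Rightarrow> complex" where
  "scaleC_complex a x = a * x"

instance
  by standard (simp_all add: scaleC_complex_def algebra_simps norm_mult scaleR_conv_of_real)

end

lemma scaleC_one: "1 *\<^sub>C x = (x :: 'a::complex_banach)"
  using scaleC_complex_of_real[of 1 x] by simp

lemma bounded_linear_scaleC: "bounded_linear (\<lambda>x :: 'a::complex_banach. a *\<^sub>C x)"
proof (rule bounded_linear_intro[where K = "cmod a"])
  fix x y :: 'a and r :: real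
  show "a *\<^sub>C (x + y) = a *\<^sub>C x + a *\<^sub>C y" by (rule scaleC_add_right)
  show "a *\<^sub>C r *\<^sub>R x = r *\<^sub>R a *\<^sub>C x"
    by (simp add: scaleC_scaleC mult.commute flip: scaleC_complex_of_real)
  show "norm (a *\<^sub>C x) \<le> norm x * cmod a" by (simp add: norm_scaleC)
qed

instantiation bcontfun :: (metric_space, complex_banach) complex_banach
begin

definition scaleC_bcontfun :: "complex \<Rightarrow> ('a \<Rightarrow>\<^sub>C 'b) \<Rightarrow> ('a \<Rightarrow>\<^sub>C 'b)" where
  "scaleC_bcontfun a f = Bcontfun (\<lambda>x. a *\<^sub>C apply_bcontfun f x)"

lemma apply_bcontfun_scaleC:
  "apply_bcontfun (a *\<^sub>C f) x = a *\<^sub>C apply_bcontfun f x" for f :: "'a \<Rightarrow>\<^sub>C 'b"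
proof -
  have "(\<lambda>x. a *\<^sub>C apply_bcontfun f x) \<in> bcontfun"
    unfolding bcontfun_def
  proof (intro CollectI conjI)
    show "continuous_on UNIV (\<lambda>x. a *\<^sub>C apply_bcontfun f x)"
      by (intro bounded_linear.continuous_on[OF bounded_linear_scaleC]) simp
    show "bounded (range (\<lambda>x. a *\<^sub>C apply_bcontfun f x))"
      using bounded_linear_image[OF bounded_apply_bcontfun bounded_linear_scaleC[of a], of f]
      by (simp add: image_image)
  qed
  then show ?thesis
    by (simp add: scaleC_bcontfun_def Bcontfun_inverse)
qed

instance
proof
  fix a b :: complex and r :: real and f g :: "'a \<Rightarrow>\<^sub>C 'b"
  show "a *\<^sub>C (f + g) = a *\<^sub>C f + a *\<^sub>C g"
    by (rule bcontfun_eqI) (simp add: apply_bcontfun_scaleC scaleC_add_right)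
  show "(a + b) *\<^sub>C f = a *\<^sub>C f + b *\<^sub>C f"
    by (rule bcontfun_eqI) (simp add: apply_bcontfun_scaleC scaleC_add_left)
  show scale2: "a *\<^sub>C b *\<^sub>C f = (a * b) *\<^sub>C f" for a b and f :: "'a \<Rightarrow>\<^sub>C 'b"
    by (rule bcontfun_eqI) (simp add: apply_bcontfun_scaleC scaleC_scaleC)
  show of_real: "complex_of_real r *\<^sub>C f = r *\<^sub>R f" for r and f :: "'a \<Rightarrow>\<^sub>C 'b"
    by (rule bcontfun_eqI) (simp add: apply_bcontfun_scaleC scaleC_complex_of_real)
  have le: "norm (a *\<^sub>C f) \<le> cmod a * norm f" for a and f :: "'a \<Rightarrow>\<^sub>C 'b"
    by (rule norm_bound)
      (simp add: apply_bcontfun_scaleC norm_scaleC mult_left_mono norm_bounded)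
  show "norm (a *\<^sub>C f) = cmod a * norm f"
  proof (cases "a = 0")
    case True
    then show ?thesis using of_real[of 0 f] by simp
  next
    case False
    have "inverse a *\<^sub>C a *\<^sub>C f = f"
      using of_real[of 1 f] False by (simp add: scale2)
    then have "norm f \<le> cmod (inverse a) * norm (a *\<^sub>C f)"
      using le[of "inverse a" "a *\<^sub>C f"] by simp
    then have "cmod a * norm f \<le> norm (a *\<^sub>C f)"
      using False by (simp add: norm_inverse inverse_eq_divide pos_le_divide_eq mult.commute norm_divide)
    then show ?thesis using le[of a f] by simp
  qed
qed

end

text \<open>As \<open>nat\<close> is discrete, this is the space of all bounded complex sequences with the
  supremum norm. Every separable complex Banach space embeds into it isometrically and
  complex-linearly, so a function on a finite set with values in some complex Banach space
  can be replaced, with all norms unchanged, by one with values in this space.\<close>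

type_synonym linfty = "nat \<Rightarrow>\<^sub>C complex"


section \<open>Analysis on the discrete cube\<close>

text \<open>Coordinates are indexed by \<open>{1..n}\<close>. A function on the cube is a HOL function of which
  only the values on \<^term>\<open>cube n\<close> matter.\<close>

definition cube :: "nat \<Rightarrow> (nat \<Rightarrow> real) set" where
  "cube n = {1..n} \<rightarrow>\<^sub>E {-1, 1}"

definition cube_mean :: "nat \<Rightarrow> ((nat \<Rightarrow> real) \<Rightarrow> 'a::real_vector) \<Rightarrow> 'a" where
  "cube_mean n f = (1 / 2 ^ n) *\<^sub>R (\<Sum>\<delta>\<in>cube n. f \<delta>)"

definition Lp_norm :: "nat \<Rightarrow> real \<Rightarrow> ((nat \<Rightarrow> real) \<Rightarrow> 'a::real_normed_vector) \<Rightarrow> real" where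
  "Lp_norm n p f = (cube_mean n (\<lambda>\<epsilon>. norm (f \<epsilon>) powr p)) powr (1 / p)"

definition walsh :: "nat set \<Rightarrow> (nat \<Rightarrow> real) \<Rightarrow> real" where
  "walsh A \<epsilon> = (\<Prod>i\<in>A. \<epsilon> i)"

definition walsh_coeff :: "nat \<Rightarrow> ((nat \<Rightarrow> real) \<Rightarrow> 'a::real_vector) \<Rightarrow> nat set \<Rightarrow> 'a" where
  "walsh_coeff n f A = cube_mean n (\<lambda>\<delta>. walsh A \<delta> *\<^sub>R f \<delta>)"

definition degree_at_most :: "nat \<Rightarrow> nat \<Rightarrow> ((nat \<Rightarrow> real) \<Rightarrow> 'a::real_vector) \<Rightarrow> bool" where
  "degree_at_most n d f \<longleftrightarrow> (\<forall>A \<subseteq> {1..n}. card A > d \<longrightarrow> walsh_coeff n f A = 0)"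

definition partial_deriv ::
  "nat \<Rightarrow> ((nat \<Rightarrow> real) \<Rightarrow> 'a::real_vector) \<Rightarrow> (nat \<Rightarrow> real) \<Rightarrow> 'a" where
  "partial_deriv i f \<epsilon> = (1 / 2) *\<^sub>R (f \<epsilon> - f (\<epsilon>(i := - \<epsilon> i)))"

definition gradient_norm :: "nat \<Rightarrow> real \<Rightarrow> ((nat \<Rightarrow> real) \<Rightarrow> 'a::real_normed_vector) \<Rightarrow> real" where
  "gradient_norm n p f =
    (cube_mean n (\<lambda>\<delta>. Lp_norm n p (\<lambda>\<epsilon>. \<Sum>i = 1..n. \<delta> i *\<^sub>R partial_deriv i f \<epsilon>) powr p)) powr (1 / p)"

end

theory Submission
  imports Defs
begin

text \<open>
  For the upper bound, fix a set \<open>S\<close> of coordinates, take a pair of independent uniform points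
  \<open>\<eta>, \<epsilon>\<close> of the cube, and exchange their coordinates outside \<open>S\<close>: \<open>y\<close> agrees with \<open>\<eta>\<close> on \<open>S\<close> and
  with \<open>\<epsilon>\<close> off \<open>S\<close>, and \<open>z\<close> is the other way round. The pair \<open>(y, z)\<close> is again uniform, so averaging
  \<open>\<Sum>i. z\<^sub>i y\<^sub>i \<partial>\<^sub>i f(y)\<close> over \<open>\<epsilon>\<close> is an operator \<open>swap_op n S\<close> whose \<open>L\<^sub>p\<close> norm on \<open>f\<close> is, by Jensen,
  at most the gradient norm. It is diagonal in the Walsh basis: \<open>w\<^sub>A\<close> is multiplied by
  the number of \<open>i \<in> A\<close> with \<open>S \<inter> A = A - {i}\<close>. If every coordinate is put into \<open>S\<close>
  independently with probability \<open>1 - t\<close>, the expected multiplier is \<open>k t (1 - t)\<^sup>k\<^sup>-\<^sup>1\<close>, where \<open>k\<close> is the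
  size of \<open>A\<close>. It remains to find a nonnegative density \<open>V\<close> for \<open>t \<in> [0,1]\<close> of small total mass with
  \<open>\<integral> V(t) k t (1 - t)\<^sup>k\<^sup>-\<^sup>1 dt = 1\<close> for \<open>1 \<le> k \<le> d\<close>: mixing the operators with this density gives
  exactly \<open>f - E f\<close>, at the cost of the mass of \<open>V\<close>.

  The density is \<open>V(t) = (1 - P(t)) / t\<close> with \<open>P\<close> the Legendre polynomial of degree \<open>d\<close>, shifted
  to \<open>[0,1]\<close> and normalised by \<open>P(0) = 1\<close>. The moment conditions hold because \<open>P\<close> is orthogonal to all
  polynomials of degree less than \<open>d\<close> (\<open>legendre_orthogonal\<close>), positivity because \<open>P \<le> 1\<close> on \<open>[0,1]\<close>
  (\<open>legendre_le_1\<close>), and the mass is exactly twice the harmonic number of \<open>d\<close>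
  (\<open>integral_legendre_quotient\<close>). This gives the inequality with \<open>2 H\<^sub>d \<le> 2 (1 + log d)\<close> as constant
  (\<open>Pisier_inequality_degree\<close>).

  For sharpness, let \<open>g(\<xi>) = log (\<surd>d + k)\<close> with \<open>k\<close> the number of coordinates \<open>-1\<close> among the first \<open>d\<close>.
  The values of \<open>g\<close> spread over an interval of length \<open>log (1 + \<surd>d)\<close>. A flip changes \<open>g\<close> by
  about \<open>1 / (\<surd>d + k)\<close>, upwards or downwards according to the sign of the coordinate. The \<open>k\<close>
  coordinates that are \<open>-1\<close> contribute \<open>O(1)\<close> to \<open>\<Sum>i. \<delta>\<^sub>i \<partial>\<^sub>i g(\<xi>)\<close> whatever the signs \<open>\<delta>\<close> are, and the
  rest is at most \<open>\<bar>\<Sum>i\<le>d. \<delta>\<^sub>i\<bar> / \<surd>d\<close> up to \<open>O(1)\<close>. This bound is uniform in \<open>\<xi>\<close>, and it has bounded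
  \<open>p\<close>-th moments in \<open>\<delta>\<close>. So the function that sends \<open>\<epsilon>\<close> to the family of all translates
  \<open>g(\<epsilon> \<eta>)\<close>, a point of the space of bounded sequences, has gradient norm \<open>O(p)\<close>, while its distance from its mean is
  at least \<open>log (1 + \<surd>d) / 2\<close> at every point.
\<close>

section \<open>Shifted Legendre polynomials\<close>

text \<open>
  The coefficients of the Legendre polynomial at \<open>1 - 2 y\<close>: the generalised binomial
  coefficient equals \<open>(-1)\<^sup>k\<close> times \<open>m + k choose k\<close>. In this form all sums over
  coefficients below are instances of Vandermonde's identity.
\<close>

definition legendre_coeff :: "nat \<Rightarrow> nat \<Rightarrow> real" where
  "legendre_coeff m k = real (m choose k) * ((- real m - 1) gchoose k)"

definition legendre :: "nat \<Rightarrow> real poly" where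
  "legendre m = (\<Sum>k\<le>m. monom (legendre_coeff m k) k)"

lemma coeff_legendre: "coeff (legendre m) k = legendre_coeff m k"
proof -
  have "coeff (legendre m) k = (if k \<le> m then legendre_coeff m k else 0)"
    unfolding legendre_def by (simp add: coeff_sum coeff_monom)
  then show ?thesis by (simp add: legendre_coeff_def)
qed

lemma legendre_coeff_0 [simp]: "legendre_coeff m 0 = 1"
  by (simp add: legendre_coeff_def)

lemma legendre_coeff_Suc:
  "(real k + 1)\<^sup>2 * legendre_coeff m (Suc k) = (real k * (real k + 1) - real m * (real m + 1)) * legendre_coeff m k"
proof -
  have 1: "(real k + 1) * real (m choose Suc k) = (real m - real k) * real (m choose k)"
    using gbinomial_mult_1[of "real m" k] by (simp add: binomial_gbinomial algebra_simps)
  have 2: "(real k + 1) * ((- real m - 1) gchoose Suc k) = (- real m - 1 - real k) * ((- real m - 1) gchoose k)"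
    using gbinomial_mult_1[of "- real m - 1" k] by (simp add: algebra_simps)
  have "(real k + 1)\<^sup>2 * legendre_coeff m (Suc k)
      = ((real k + 1) * real (m choose Suc k)) * ((real k + 1) * ((- real m - 1) gchoose Suc k))"
    by (simp add: legendre_coeff_def power2_eq_square algebra_simps)
  also have "\<dots> = ((real m - real k) * (- real m - 1 - real k)) * legendre_coeff m k"
    unfolding 1 2 by (simp add: legendre_coeff_def)
  also have "\<dots> = (real k * (real k + 1) - real m * (real m + 1)) * legendre_coeff m k"
    by (simp add: algebra_simps)
  finally show ?thesis .
qed

text \<open>
  The Legendre equation \<open>(y (1 - y) P')' = - m (m + 1) P\<close> is the two-term recursion of the
  coefficients. Orthogonality and the bound \<open>P \<le> 1\<close> both follow from it.
\<close>

lemma legendre_ode: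
  "pderiv ([:0, 1, -1:] * pderiv (legendre m)) = smult (- real m * (real m + 1)) (legendre m)"
proof (rule poly_eqI)
  fix k
  show "coeff (pderiv ([:0, 1, -1:] * pderiv (legendre m))) k = coeff (smult (- real m * (real m + 1)) (legendre m)) k"
    using legendre_coeff_Suc[of k m]
    by (cases k) (simp_all add: coeff_pderiv coeff_legendre coeff_pCons algebra_simps power2_eq_square split: nat.split)
qed

lemma poly_legendre_0: "poly (legendre m) 0 = 1"
  by (simp add: poly_0_coeff_0 coeff_legendre)

lemma Vandermonde_diagonal: "(\<Sum>k\<le>m. real (m choose k) * (a gchoose k)) = (a + real m) gchoose m"
proof -
  have "(\<Sum>k\<le>m. real (m choose k) * (a gchoose k)) = (\<Sum>k\<in>{0..m}. (a gchoose k) * (real m gchoose (m - k)))"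
    by (intro sum.cong) (auto simp: binomial_gbinomial[symmetric] binomial_symmetric[symmetric])
  then show ?thesis by (simp add: gbinomial_Vandermonde)
qed

lemma poly_legendre_1: "poly (legendre m) 1 = (- 1) ^ m"
proof -
  have "poly (legendre m) 1 = (\<Sum>k\<le>m. legendre_coeff m k)"
    by (simp add: legendre_def poly_sum poly_monom)
  also have "\<dots> = (- 1 :: real) gchoose m"
    unfolding legendre_coeff_def by (subst Vandermonde_diagonal) simp
  also have "\<dots> = (- 1) ^ m"
    using gbinomial_minus[of "1::real" m]
    by (simp add: gbinomial_of_nat_symmetric flip: binomial_gbinomial)
  finally show ?thesis .
qed

lemma poly_integrable: "(\<lambda>y. poly q y) integrable_on {0..1::real}"
  by (intro integrable_continuous_real continuous_intros)

lemma integral_poly_pderiv: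
  "integral {0..1} (poly (pderiv q)) = poly q 1 - poly q (0::real)"
proof (rule integral_unique, rule fundamental_theorem_of_calculus)
  show "(poly q has_vector_derivative poly (pderiv q) x) (at x within {0..1})" for x
    using DERIV_subset[OF poly_DERIV[of q x]] 
    by (simp add: has_real_derivative_iff_has_vector_derivative)
qed simp

lemma integral_poly_smult:
  "integral {0..1} (poly (smult c q)) = c * integral {0..1::real} (poly q)"
proof -
  have "poly (smult c q) = (\<lambda>y. c * poly q y)" by (rule ext) simp
  then show ?thesis by simp
qed

lemma integral_poly_by_parts:
  assumes "poly (q * r) 0 = 0" "poly (q * r) (1::real) = 0"
  shows "integral {0..1} (poly (pderiv q * r)) = - integral {0..1} (poly (q * pderiv r))"
proof -
  have "integral {0..1} (\<lambda>y. poly (pderiv q * r) y + poly (q * pderiv r) y) = 0"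
    using integral_poly_pderiv[of "q * r"] assms
    by (simp add: pderiv_mult poly_add[abs_def] algebra_simps flip: poly_mult)
  then show ?thesis
    using integral_add[OF poly_integrable[of "pderiv q * r"] poly_integrable[of "q * pderiv r"]]
    by (simp add: poly_mult[abs_def])
qed

text \<open>
  Integrate the Legendre equation against \<open>(1 - y)\<^sup>s\<close> and move both derivatives onto the power. With
  \<open>M\<^sub>s\<close> the \<open>s\<close>-th moment this gives \<open>(m (m + 1) - s (s + 1)) M\<^sub>s = - s\<^sup>2 M\<^sub>s\<^sub>-\<^sub>1\<close>, so the moments
  vanish one after the other as long as \<open>s < m\<close>.
\<close>

lemma legendre_orthogonal:
  assumes "s < m"
  shows "integral {0..1} (\<lambda>y. poly (legendre m) y * (1 - y) ^ s) = 0"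
  using assms
proof (induction s)
  case 0
  have "integral {0..1} (poly (smult (- real m * (real m + 1)) (legendre m))) = 0"
    unfolding legendre_ode[symmetric] by (subst integral_poly_pderiv) simp
  then show ?case using 0 by (simp only: integral_poly_smult) simp
next
  case (Suc s)
  let ?L = "legendre m" and ?M = "\<lambda>s. integral {0..1} (\<lambda>y. poly (legendre m) y * (1 - y) ^ s)"
  let ?u = "[:1, -1:] :: real poly"
  have int: "(\<lambda>y. poly (legendre m) y * (1 - y) ^ s) integrable_on {0..1}" for s
    using poly_integrable[of "?L * ?u ^ s"] by simp
  have du: "pderiv (?u ^ Suc s) = smult (- (real s + 1)) (?u ^ s)" for s
    by (simp only: pderiv_power_Suc) (simp add: pderiv_pCons add.commute)
  have "poly (smult (- real m * (real m + 1)) ?L * ?u ^ Suc s)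
      = (\<lambda>y. (- real m * (real m + 1)) * (poly ?L y * (1 - y) ^ Suc s))"
    by (rule ext) (simp add: poly_power del: power_Suc)
  then have "- real m * (real m + 1) * ?M (Suc s)
      = integral {0..1} (poly (smult (- real m * (real m + 1)) ?L * ?u ^ Suc s))"
    by (simp only: integral_mult_right)
  also have "\<dots> = - integral {0..1} (poly (([:0, 1, -1:] * pderiv ?L) * pderiv (?u ^ Suc s)))"
    unfolding legendre_ode[symmetric] by (rule integral_poly_by_parts) auto
  also have "([:0, 1, -1:] * pderiv ?L) * pderiv (?u ^ Suc s) = smult (- (real s + 1)) (pderiv ?L * (?u ^ Suc s * [:0,1:]))"
  proof -
    have "[:0, 1, -1:] = ?u * [:0, 1:]" by simp
    then show ?thesis unfolding du by (simp del: mult_pCons_left mult_pCons_right add: algebra_simps)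
  qed
  also have "- integral {0..1} (poly \<dots>) = (real s + 1) * integral {0..1} (poly (pderiv ?L * (?u ^ Suc s * [:0,1:])))"
    by (simp only: integral_poly_smult)
  also have "integral {0..1} (poly (pderiv ?L * (?u ^ Suc s * [:0,1:]))) = - integral {0..1} (poly (?L * pderiv (?u ^ Suc s * [:0,1:])))"
    by (rule integral_poly_by_parts) auto
  also have "poly (?L * pderiv (?u ^ Suc s * [:0,1:])) = (\<lambda>y. (real s + 2) * (poly ?L y * (1 - y) ^ Suc s) - (real s + 1) * (poly ?L y * (1 - y) ^ s))"
    unfolding pderiv_mult du by (rule ext) (simp add: algebra_simps pderiv_pCons)
  also have "integral {0..1} \<dots> = (real s + 2) * ?M (Suc s) - (real s + 1) * ?M s"
    by (subst integral_diff) (auto intro!: integrable_on_cmult_left int simp del: power_Suc)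
  also have "?M s = 0" using Suc by simp
  finally have "(real m * (real m + 1) - (real s + 1) * (real s + 2)) * ?M (Suc s) = 0"
    by (simp add: algebra_simps)
  moreover have "(real s + 1) * (real s + 2) < real m * (real m + 1)"
    using Suc.prems by (intro mult_strict_mono) auto
  ultimately show ?case by simp
qed

text \<open>
  Sonin's argument: \<open>\<Phi> = m (m + 1) P\<^sup>2 + y (1 - y) P'\<^sup>2\<close> dominates \<open>m (m + 1) P\<^sup>2\<close>, and by the Legendre
  equation \<open>\<Phi>' = (2 y - 1) P'\<^sup>2\<close>. Hence \<open>\<Phi>\<close> is largest at the end points of the interval, where it
  equals \<open>m (m + 1)\<close>.
\<close>

lemma legendre_le_1:
  assumes "0 \<le> y" "y \<le> 1"
  shows "poly (legendre m) y \<le> 1"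
proof (cases "m = 0")
  case True
  then show ?thesis by (simp add: legendre_def)
next
  case False
  let ?L = "legendre m" and ?L' = "pderiv (legendre m)" and ?N = "real m * (real m + 1)"
  let ?w = "[:0, 1, -1:] :: real poly"
  have N: "?N > 0" using False by simp
  define \<Phi> where "\<Phi> = smult ?N (?L\<^sup>2) + ?w * ?L'\<^sup>2"
  have poly_\<Phi>': "poly (pderiv \<Phi>) t = (2 * t - 1) * (poly ?L' t)\<^sup>2" for t
  proof -
    have "poly (pderiv (?w * ?L')) t = - ?N * poly ?L t" using legendre_ode[of m] by simp
    then have ode: "t * (1 - t) * poly (pderiv ?L') t = - ?N * poly ?L t - (1 - 2 * t) * poly ?L' t"
      unfolding pderiv_mult by (simp add: pderiv_pCons algebra_simps)
    have "poly (pderiv \<Phi>) t = 2 * ?N * (poly ?L t * poly ?L' t) + (1 - 2 * t) * (poly ?L' t)\<^sup>2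
        + 2 * poly ?L' t * (t * (1 - t) * poly (pderiv ?L') t)"
      unfolding \<Phi>_def power2_eq_square pderiv_add pderiv_mult pderiv_smult
      by (simp add: pderiv_pCons algebra_simps)
    then show ?thesis
      unfolding ode by (simp add: power2_eq_square algebra_simps)
  qed
  have ends: "poly \<Phi> 0 = ?N" "poly \<Phi> 1 = ?N"
    by (simp_all add: \<Phi>_def poly_legendre_0 poly_legendre_1 power_mult[symmetric] power2_eq_square
        flip: power_mult_distrib)
  have "poly \<Phi> y \<le> ?N"
  proof (cases "y \<le> 1 / 2")
    case True
    have "poly \<Phi> y \<le> poly \<Phi> 0"
      using True by (intro DERIV_nonpos_imp_nonincreasing[OF assms(1)])
        (auto intro!: exI poly_DERIV simp: poly_\<Phi>' mult_nonpos_nonneg)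
    then show ?thesis by (simp add: ends)
  next
    case False
    have "poly \<Phi> y \<le> poly \<Phi> 1"
      using False by (intro DERIV_nonneg_imp_nondecreasing[OF assms(2)])
        (auto intro!: exI poly_DERIV simp: poly_\<Phi>')
    then show ?thesis by (simp add: ends)
  qed
  moreover have "poly \<Phi> y = ?N * (poly ?L y)\<^sup>2 + y * (1 - y) * (poly ?L' y)\<^sup>2"
    by (simp add: \<Phi>_def algebra_simps)
  moreover have "0 \<le> y * (1 - y) * (poly ?L' y)\<^sup>2" using assms by simp
  ultimately have "?N * (poly ?L y)\<^sup>2 \<le> ?N * 1" by linarith
  then have "(poly ?L y)\<^sup>2 \<le> 1" using N mult_le_cancel_left_pos by blast
  then show ?thesis by (simp add: power2_le_iff_abs_le abs_square_le_1)
qed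

text \<open>
  The polynomial \<open>(1 - P(y)) / y\<close>, the density used to mix the swap operators.
\<close>

definition legendre_quotient where "legendre_quotient m = (\<Sum>k<m. monom (- legendre_coeff m (Suc k)) k)"

lemma poly_legendre_quotient: "y * poly (legendre_quotient m) y = 1 - poly (legendre m) y"
proof -
  have "poly (legendre m) y = (\<Sum>k\<le>m. legendre_coeff m k * y ^ k)"
    by (simp add: legendre_def poly_sum poly_monom)
  also have "\<dots> = 1 + (\<Sum>k<m. legendre_coeff m (Suc k) * y ^ Suc k)"
    by (subst sum.atMost_shift) simp
  finally show ?thesis
    by (simp add: legendre_quotient_def poly_sum poly_monom sum_distrib_left sum_negf algebra_simps)
qed

text \<open>
  Division by \<open>k\<close> makes the right-hand side a term of Vandermonde's identity; this makes the
  integral of the quotient computable by induction on \<open>m\<close>.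
\<close>

lemma legendre_coeff_diff:
  assumes "m > 0"
  shows "legendre_coeff m k - legendre_coeff (m - 1) k = 2 * real k / real m * (real (m choose k) * ((- real m) gchoose k))"
proof -
  have 1: "((- real m) - real k) * ((- real m) gchoose k) = - real m * ((- real m - 1) gchoose k)"
    by (rule gbinomial_absorb_comp)
  have 2: "(real m - real k) * real (m choose k) = real m * real ((m - 1) choose k)"
    using gbinomial_absorb_comp[of "real m" k] assms by (simp add: binomial_gbinomial of_nat_diff)
  have 3: "((- real m - 1) gchoose k) = (real m + real k) / real m * ((- real m) gchoose k)"
    using 1 assms by (simp add: field_simps)
  have 4: "real ((m - 1) choose k) = (real m - real k) / real m * real (m choose k)"
    using 2 assms by (simp add: field_simps)
  have 5: "- real (m - 1) - 1 = - real m" using assms by (simp add: of_nat_diff)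
  show ?thesis
    unfolding legendre_coeff_def 5 3 4 using assms by (simp add: field_simps)
qed

lemma integral_legendre_quotient_sum: "integral {0..1} (poly (legendre_quotient m)) = - (\<Sum>k=1..m. legendre_coeff m k / real k)"
proof -
  have i: "((\<lambda>y. y ^ k) has_integral 1 / (real k + 1)) {0..1::real}" for k
  proof -
    have "((\<lambda>y. y ^ k) has_integral (1 ^ Suc k / (real k + 1) - 0 ^ Suc k / (real k + 1))) {0..1::real}"
    proof (rule fundamental_theorem_of_calculus)
      fix y :: real
      have "((\<lambda>y. y ^ Suc k / (real k + 1)) has_real_derivative (real (Suc k) * y ^ k) / (real k + 1)) (at y within {0..1})"
        by (auto intro!: derivative_eq_intros simp del: power_Suc)
      moreover have "(real (Suc k) * y ^ k) / (real k + 1) = y ^ k" by (simp add: add.commute)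
      ultimately show "((\<lambda>y. y ^ Suc k / (real k + 1)) has_vector_derivative y ^ k) (at y within {0..1})"
        by (simp add: has_real_derivative_iff_has_vector_derivative)
    qed simp
    then show ?thesis by simp
  qed
  have "(poly (legendre_quotient m) has_integral (\<Sum>k<m. - legendre_coeff m (Suc k) * (1 / (real k + 1)))) {0..1}"
  proof -
    have "poly (legendre_quotient m) = (\<lambda>y. \<Sum>k<m. - legendre_coeff m (Suc k) * y ^ k)"
      by (rule ext) (simp add: legendre_quotient_def poly_sum poly_monom)
    then show ?thesis by (simp only:) (intro has_integral_sum has_integral_mult_right i finite_lessThan)
  qed
  then show ?thesis
    using sum_bounds_lt_plus1[of "\<lambda>k. legendre_coeff m k / real k" m]
    by (simp add: integral_unique sum_negf add.commute)
qed

text \<open>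
  By \<open>legendre_coeff_diff\<close> the step from \<open>m\<close> to \<open>m + 1\<close> adds \<open>-2 / (m + 1)\<close> times the sum over \<open>k \<ge> 1\<close>
  of \<open>(m + 1 choose k)\<close> times \<open>(- m - 1 choose k)\<close>. Over all \<open>k \<ge> 0\<close> this sum is \<open>0 choose (m + 1) = 0\<close>,
  so without its first term it is \<open>-1\<close>.
\<close>

lemma integral_legendre_quotient: "integral {0..1} (poly (legendre_quotient m)) = 2 * harm m"
proof (induction m)
  case 0
  then show ?case by (simp add: legendre_quotient_def harm_def)
next
  case (Suc m)
  let ?g = "\<lambda>k. real (Suc m choose k) * ((- real (Suc m)) gchoose k)"
  have "(\<Sum>k=1..m. legendre_coeff m k / real k) = (\<Sum>k=1..Suc m. legendre_coeff m k / real k)"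
    by (simp add: legendre_coeff_def)
  then have "(\<Sum>k=1..Suc m. legendre_coeff (Suc m) k / real k) - (\<Sum>k=1..m. legendre_coeff m k / real k)
     = (\<Sum>k=1..Suc m. (legendre_coeff (Suc m) k - legendre_coeff m k) / real k)"
    by (simp only: sum_subtractf diff_divide_distrib)
  also have "\<dots> = (\<Sum>k=1..Suc m. 2 / real (Suc m) * ?g k)"
    using legendre_coeff_diff[of "Suc m"] by (intro sum.cong) auto
  also have "\<dots> = 2 / real (Suc m) * (\<Sum>k=1..Suc m. ?g k)"
    by (simp only: sum_distrib_left)
  also have "(\<Sum>k=1..Suc m. ?g k) = (\<Sum>k\<le>Suc m. ?g k) - 1"
    unfolding sum_bounds_lt_plus1[symmetric] by (subst sum.atMost_shift) simp
  also have "(\<Sum>k\<le>Suc m. ?g k) = 0"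
    by (subst Vandermonde_diagonal) (simp add: gbinomial_0(2))
  finally show ?case using Suc unfolding integral_legendre_quotient_sum harm_Suc
    by (simp only: divide_inverse diff_0 mult_minus_right mult_1_right distrib_left)
qed

lemma harm_le: "m > 0 \<Longrightarrow> harm m \<le> 1 + ln (real m)"
proof (induction m rule: nat_induct_non_zero)
  case 1
  then show ?case by (simp add: harm_def)
next
  case (Suc m)
  have "ln (real m / (real m + 1)) \<le> real m / (real m + 1) - 1"
    using Suc.hyps by (intro ln_le_minus_one) simp
  then have "inverse (real m + 1) \<le> ln (real m + 1) - ln (real m)"
    using Suc.hyps by (simp add: ln_div field_simps)
  then show ?case using Suc.IH by (simp add: harm_Suc add.commute)
qed

section \<open>Means and Walsh expansions on the cube\<close>

lemma finite_cube [simp]: "finite (cube n)"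
  unfolding cube_def by (intro finite_PiE) auto

lemma card_cube: "card (cube n) = 2 ^ n"
proof -
  have "card {-1, 1 :: real} = 2" by simp
  then show ?thesis unfolding cube_def by (subst card_PiE) (simp_all del: card_insert_disjoint)
qed

lemma cube_nth: "\<epsilon> \<in> cube n \<Longrightarrow> i \<in> {1..n} \<Longrightarrow> \<epsilon> i = -1 \<or> \<epsilon> i = 1"
  using PiE_mem[of \<epsilon> "{1..n}" "\<lambda>_. {-1, 1}" i] by (simp add: cube_def)

lemma cube_square: "\<epsilon> \<in> cube n \<Longrightarrow> i \<in> {1..n} \<Longrightarrow> \<epsilon> i * \<epsilon> i = 1"
  using cube_nth by fastforce

lemma cube_flip:
  assumes "\<epsilon> \<in> cube n" "i \<in> {1..n}"
  shows "\<epsilon>(i := - \<epsilon> i) \<in> cube n"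
proof -
  have "- \<epsilon> i \<in> {-1, 1}" using cube_nth[OF assms] by auto
  then show ?thesis
    using assms PiE_fun_upd[of "- \<epsilon> i" "\<lambda>_. {-1, 1}" i \<epsilon> "{1..n}"] by (simp add: cube_def insert_absorb)
qed

lemma cube_override: "\<epsilon> \<in> cube n \<Longrightarrow> \<eta> \<in> cube n \<Longrightarrow> override_on \<epsilon> \<eta> S \<in> cube n"
  unfolding cube_def by (auto simp: PiE_iff extensional_def override_on_def)

lemma cube_mult:
  assumes "\<epsilon> \<in> cube n" "\<eta> \<in> cube n"
  shows "restrict (\<lambda>i. \<epsilon> i * \<eta> i) {1..n} \<in> cube n"
proof -
  have "\<epsilon> i * \<eta> i \<in> {-1, 1}" if "i \<in> {1..n}" for i
    using cube_nth[OF assms(1) that] cube_nth[OF assms(2) that] by auto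
  then show ?thesis unfolding cube_def by (intro restrict_PiE_iff[THEN iffD2] ballI)
qed

lemma cube_mean_add: "cube_mean n (\<lambda>\<epsilon>. f \<epsilon> + g \<epsilon>) = cube_mean n f + cube_mean n g"
  by (simp add: cube_mean_def sum.distrib algebra_simps)

lemma cube_mean_sum: "cube_mean n (\<lambda>\<epsilon>. \<Sum>i\<in>I. f i \<epsilon>) = (\<Sum>i\<in>I. cube_mean n (f i))"
  unfolding cube_mean_def by (subst sum.swap) (simp add: scaleR_sum_right)

lemma cube_mean_scaleR: "cube_mean n (\<lambda>\<epsilon>. c *\<^sub>R f \<epsilon>) = c *\<^sub>R cube_mean n f"
  unfolding cube_mean_def by (simp add: scaleR_sum_right[symmetric] mult.commute)

lemma cube_mean_scaleR_left: "cube_mean n (\<lambda>\<epsilon>. a \<epsilon> *\<^sub>R x) = cube_mean n a *\<^sub>R x"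
  unfolding cube_mean_def by (simp add: scaleR_sum_left[symmetric])

lemma cube_mean_mult: "cube_mean n (\<lambda>\<epsilon>. c * f \<epsilon> :: real) = c * cube_mean n f"
  using cube_mean_scaleR[of n c f] by simp

lemma cube_mean_const [simp]: "cube_mean n (\<lambda>\<epsilon>. x) = x"
  by (simp add: cube_mean_def card_cube sum_constant_scaleR)

lemma cube_mean_mono: "(\<And>\<epsilon>. \<epsilon> \<in> cube n \<Longrightarrow> f \<epsilon> \<le> (g \<epsilon> :: real)) \<Longrightarrow> cube_mean n f \<le> cube_mean n g"
  unfolding cube_mean_def by (auto intro!: divide_right_mono sum_mono)

lemma cube_mean_nonneg: "(\<And>\<epsilon>. \<epsilon> \<in> cube n \<Longrightarrow> 0 \<le> (g \<epsilon> :: real)) \<Longrightarrow> 0 \<le> cube_mean n g"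
  using cube_mean_mono[of n "\<lambda>_. 0" g] by simp

lemma cube_mean_cong: "(\<And>\<epsilon>. \<epsilon> \<in> cube n \<Longrightarrow> f \<epsilon> = g \<epsilon>) \<Longrightarrow> cube_mean n f = cube_mean n g"
  unfolding cube_mean_def by simp

lemma cube_mean_prod:
  "cube_mean n (\<lambda>\<epsilon>. \<Prod>i\<in>{1..n}. h i (\<epsilon> i)) = (\<Prod>i\<in>{1..n}. (h i (-1) + h i 1) / 2 :: real)"
proof -
  have "(\<Sum>\<epsilon>\<in>cube n. \<Prod>i\<in>{1..n}. h i (\<epsilon> i)) = (\<Prod>i\<in>{1..n}. h i (-1) + h i 1)"
    unfolding cube_def by (subst prod_sum_PiE[symmetric]) auto
  then show ?thesis by (simp add: cube_mean_def prod_dividef)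
qed

text \<open>
  Summing \<open>w\<^sub>A(\<epsilon>) w\<^sub>A(\<delta>)\<close> over all \<open>A\<close> gives \<open>\<Prod>i. (1 + \<epsilon>\<^sub>i \<delta>\<^sub>i)\<close>, which is \<open>2\<^sup>n\<close> times the indicator
  of \<open>\<delta> = \<epsilon>\<close>.
\<close>

lemma walsh_expansion:
  assumes "\<epsilon> \<in> cube n"
  shows "f \<epsilon> = (\<Sum>A\<in>Pow {1..n}. walsh A \<epsilon> *\<^sub>R walsh_coeff n f A)"
proof -
  have kernel: "(\<Sum>A\<in>Pow {1..n}. walsh A \<epsilon> * walsh A \<delta>) = (if \<delta> = \<epsilon> then 2 ^ n else 0)" if "\<delta> \<in> cube n" for \<delta>
  proof -
    have "(\<Sum>A\<in>Pow {1..n}. walsh A \<epsilon> * walsh A \<delta>) = (\<Prod>i\<in>{1..n}. \<epsilon> i * \<delta> i + 1)"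
      by (subst prod_add) (auto simp: walsh_def prod.distrib)
    also have "\<dots> = (if \<delta> = \<epsilon> then 2 ^ n else 0)"
    proof (cases "\<delta> = \<epsilon>")
      case True
      then show ?thesis using cube_square[OF assms] by simp
    next
      case False
      then obtain i where i: "i \<in> {1..n}" "\<delta> i \<noteq> \<epsilon> i"
        using PiE_ext[of \<delta> "{1..n}" "\<lambda>_. {-1, 1}" \<epsilon>] assms \<open>\<delta> \<in> cube n\<close> unfolding cube_def by blast
      then have "\<epsilon> i * \<delta> i + 1 = 0" using cube_nth[OF assms i(1)] cube_nth[OF \<open>\<delta> \<in> cube n\<close> i(1)] by auto
      then show ?thesis using i False by (auto intro!: prod_zero)
    qed
    finally show ?thesis .
  qed
  have "(\<Sum>A\<in>Pow {1..n}. walsh A \<epsilon> *\<^sub>R walsh_coeff n f A)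
      = cube_mean n (\<lambda>\<delta>. \<Sum>A\<in>Pow {1..n}. (walsh A \<epsilon> * walsh A \<delta>) *\<^sub>R f \<delta>)"
    unfolding cube_mean_sum walsh_coeff_def by (simp add: cube_mean_scaleR[symmetric])
  also have "\<dots> = cube_mean n (\<lambda>\<delta>. (if \<delta> = \<epsilon> then 2 ^ n else 0) *\<^sub>R f \<delta>)"
    by (intro cube_mean_cong) (simp only: scaleR_sum_left[symmetric] kernel)
  also have "\<dots> = cube_mean n (\<lambda>\<delta>. if \<delta> = \<epsilon> then 2 ^ n *\<^sub>R f \<epsilon> else 0)"
    by (intro cube_mean_cong) simp
  also have "\<dots> = f \<epsilon>"
    using assms by (simp add: cube_mean_def)
  finally show ?thesis ..
qed

lemma walsh_flip:
  assumes "finite A"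
  shows "walsh A (\<epsilon>(i := - \<epsilon> i)) = (if i \<in> A then - walsh A \<epsilon> else walsh A \<epsilon>)"
proof (cases "i \<in> A")
  case True
  then show ?thesis using assms by (simp add: walsh_def prod.remove)
next
  case False
  then show ?thesis by (auto simp: walsh_def intro!: prod.cong)
qed

lemma partial_deriv_expansion:
  assumes "\<epsilon> \<in> cube n" "i \<in> {1..n}"
  shows "partial_deriv i f \<epsilon> = (\<Sum>A\<in>Pow {1..n}. (of_bool (i \<in> A) * walsh A \<epsilon>) *\<^sub>R walsh_coeff n f A)"
proof -
  have "partial_deriv i f \<epsilon> = (\<Sum>A\<in>Pow {1..n}. (1/2) *\<^sub>R (walsh A \<epsilon> *\<^sub>R walsh_coeff n f A
      - walsh A (\<epsilon>(i := - \<epsilon> i)) *\<^sub>R walsh_coeff n f A))"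
    unfolding partial_deriv_def
    using walsh_expansion[OF assms(1), of f] walsh_expansion[OF cube_flip[OF assms], of f]
    by (simp only: sum_subtractf[symmetric] scaleR_sum_right[symmetric])
  also have "\<dots> = (\<Sum>A\<in>Pow {1..n}. (of_bool (i \<in> A) * walsh A \<epsilon>) *\<^sub>R walsh_coeff n f A)"
  proof (rule sum.cong[OF refl])
    fix A assume "A \<in> Pow {1..n}"
    then have "finite A" by (auto intro: finite_subset)
    then show "(1/2) *\<^sub>R (walsh A \<epsilon> *\<^sub>R walsh_coeff n f A - walsh A (\<epsilon>(i := - \<epsilon> i)) *\<^sub>R walsh_coeff n f A)
        = (of_bool (i \<in> A) * walsh A \<epsilon>) *\<^sub>R walsh_coeff n f A"
      by (simp add: walsh_flip flip: scaleR_left_diff_distrib)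
  qed
  finally show ?thesis .
qed

section \<open>Swap operators\<close>

text \<open>
  The factor \<open>y\<^sub>i\<close> turns \<open>\<partial>\<^sub>i\<close> into the operator \<open>w\<^sub>A \<mapsto> w\<^bsub>A - {i}\<^esub>\<close> for \<open>i \<in> A\<close>, whose result does not
  depend on \<open>y\<^sub>i\<close>. Since \<open>z y\<close> is uniform for every fixed \<open>y\<close>, it does not change the norm of the
  randomised gradient.
\<close>

definition swapped_deriv where
  "swapped_deriv n f y z = (\<Sum>i=1..n. (z i * y i) *\<^sub>R partial_deriv i f y)"

text \<open>
  The two arguments are \<open>\<eta>\<close> and \<open>\<epsilon>\<close> after the exchange of their coordinates outside \<open>S\<close>.
\<close>

definition swap_op where
  "swap_op n S f \<eta> = cube_mean n (\<lambda>\<epsilon>. swapped_deriv n f (override_on \<epsilon> \<eta> S) (override_on \<eta> \<epsilon> S))"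

text \<open>
  The expression is \<open>z\<^sub>i\<close> times the product of the \<open>y\<^sub>j\<close> over \<open>j \<in> A - {i}\<close>. Each factor is a coordinate either of \<open>\<eta>\<close>
  or of the averaged point \<open>\<epsilon>\<close>; one factor of the second kind makes the mean vanish.
\<close>

lemma cube_mean_swapped_walsh:
  assumes \<eta>: "\<eta> \<in> cube n" and A: "A \<subseteq> {1..n}" and i: "i \<in> A"
  shows "cube_mean n (\<lambda>\<epsilon>. override_on \<eta> \<epsilon> S i * (override_on \<epsilon> \<eta> S i * walsh A (override_on \<epsilon> \<eta> S)))
    = of_bool (i \<notin> S \<and> A - {i} \<subseteq> S) * walsh A \<eta>"
proof -
  have fin: "finite A" using A finite_subset by blast
  \<comment> \<open>The factor with index \<open>j\<close> of the product as a function of \<open>t = \<epsilon>\<^sub>j\<close>; the sign is averaged iff \<open>j = i\<close> and \<open>j \<in> S\<close> are both true or both false.\<close>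
  define h where "h j t = (if j \<in> A then if (j = i) = (j \<in> S) then t else \<eta> j else 1)" for j and t :: real
  have "override_on \<eta> \<epsilon> S i * (override_on \<epsilon> \<eta> S i * walsh A (override_on \<epsilon> \<eta> S)) = (\<Prod>j\<in>{1..n}. h j (\<epsilon> j))"
    if \<epsilon>: "\<epsilon> \<in> cube n" for \<epsilon>
  proof -
    let ?y = "override_on \<epsilon> \<eta> S"
    have "?y i * walsh A ?y = (?y i * ?y i) * (\<Prod>j\<in>A-{i}. ?y j)"
      using i fin by (simp add: walsh_def prod.remove)
    also have "?y i * ?y i = 1" using cube_square[OF cube_override[OF \<epsilon> \<eta>]] i A by blast
    finally have *: "?y i * walsh A ?y = (\<Prod>j\<in>A-{i}. ?y j)" by simp
    have "override_on \<eta> \<epsilon> S i * (?y i * walsh A ?y) = h i (\<epsilon> i) * (\<Prod>j\<in>A-{i}. h j (\<epsilon> j))"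
    proof -
      have "override_on \<eta> \<epsilon> S i = h i (\<epsilon> i)" using i by (simp add: h_def override_on_def)
      moreover have "(\<Prod>j\<in>A-{i}. ?y j) = (\<Prod>j\<in>A-{i}. h j (\<epsilon> j))"
        by (rule prod.cong) (auto simp: h_def override_on_def)
      ultimately show ?thesis using * by simp
    qed
    also have "\<dots> = (\<Prod>j\<in>A. h j (\<epsilon> j))" using i fin by (simp add: prod.remove)
    also have "\<dots> = (\<Prod>j\<in>{1..n}. h j (\<epsilon> j))"
      using A by (intro prod.mono_neutral_left) (auto simp: h_def)
    finally show ?thesis .
  qed
  then have "cube_mean n (\<lambda>\<epsilon>. override_on \<eta> \<epsilon> S i * (override_on \<epsilon> \<eta> S i * walsh A (override_on \<epsilon> \<eta> S)))
      = (\<Prod>j\<in>{1..n}. (h j (-1) + h j 1) / 2)"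
    by (subst cube_mean_prod[symmetric]) (rule cube_mean_cong)
  also have "\<dots> = (\<Prod>j\<in>A. (h j (-1) + h j 1) / 2)"
    using A by (intro prod.mono_neutral_right) (auto simp: h_def)
  also have "\<dots> = of_bool (i \<notin> S \<and> A - {i} \<subseteq> S) * walsh A \<eta>"
  proof (cases "i \<notin> S \<and> A - {i} \<subseteq> S")
    case True
    then show ?thesis by (auto simp: walsh_def h_def intro!: prod.cong)
  next
    case False
    then obtain j where "j \<in> A" "(j = i) = (j \<in> S)" using i by blast
    then show ?thesis using False fin by (auto simp: h_def intro!: prod_zero bexI[of _ j])
  qed
  finally show ?thesis .
qed

lemma swap_op_expansion:
  assumes \<eta>: "\<eta> \<in> cube n"
  shows "swap_op n S f \<eta> = (\<Sum>A\<in>Pow {1..n}.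
    ((\<Sum>i\<in>A. of_bool (i \<notin> S \<and> A - {i} \<subseteq> S)) * walsh A \<eta>) *\<^sub>R walsh_coeff n f A)"
proof -
  have "swapped_deriv n f y z = (\<Sum>A\<in>Pow {1..n}. (\<Sum>i\<in>A. z i * (y i * walsh A y)) *\<^sub>R walsh_coeff n f A)"
    if "y \<in> cube n" for y z
  proof -
    have "swapped_deriv n f y z = (\<Sum>i=1..n. \<Sum>A\<in>Pow {1..n}. (of_bool (i \<in> A) * (z i * (y i * walsh A y))) *\<^sub>R walsh_coeff n f A)"
      unfolding swapped_deriv_def by (intro sum.cong) (auto simp: partial_deriv_expansion[OF that] scaleR_sum_right mult_ac)
    also have "\<dots> = (\<Sum>A\<in>Pow {1..n}. (\<Sum>i=1..n. of_bool (i \<in> A) * (z i * (y i * walsh A y))) *\<^sub>R walsh_coeff n f A)"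
      by (subst sum.swap) (simp only: scaleR_sum_left)
    also have "\<dots> = (\<Sum>A\<in>Pow {1..n}. (\<Sum>i\<in>A. z i * (y i * walsh A y)) *\<^sub>R walsh_coeff n f A)"
    proof (rule sum.cong[OF refl])
      fix A assume "A \<in> Pow {1..n}"
      then have "(\<Sum>i=1..n. of_bool (i \<in> A) * (z i * (y i * walsh A y))) = (\<Sum>i\<in>A. z i * (y i * walsh A y))"
        by (intro sum.mono_neutral_cong_right) auto
      then show "(\<Sum>i=1..n. of_bool (i \<in> A) * (z i * (y i * walsh A y))) *\<^sub>R walsh_coeff n f A
        = (\<Sum>i\<in>A. z i * (y i * walsh A y)) *\<^sub>R walsh_coeff n f A" by (rule arg_cong)
    qed
    finally show ?thesis .
  qed
  then have "swap_op n S f \<eta> = cube_mean n (\<lambda>\<epsilon>. \<Sum>A\<in>Pow {1..n}.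
      (\<Sum>i\<in>A. override_on \<eta> \<epsilon> S i * (override_on \<epsilon> \<eta> S i * walsh A (override_on \<epsilon> \<eta> S))) *\<^sub>R walsh_coeff n f A)"
    unfolding swap_op_def by (intro cube_mean_cong) (simp add: cube_override \<eta>)
  also have "\<dots> = (\<Sum>A\<in>Pow {1..n}. (\<Sum>i\<in>A. of_bool (i \<notin> S \<and> A - {i} \<subseteq> S) * walsh A \<eta>) *\<^sub>R walsh_coeff n f A)"
    unfolding cube_mean_sum cube_mean_scaleR_left
  proof (rule sum.cong[OF refl])
    fix A assume A: "A \<in> Pow {1..n}"
    have "(\<Sum>i\<in>A. cube_mean n (\<lambda>\<epsilon>. override_on \<eta> \<epsilon> S i * (override_on \<epsilon> \<eta> S i * walsh A (override_on \<epsilon> \<eta> S))))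
      = (\<Sum>i\<in>A. of_bool (i \<notin> S \<and> A - {i} \<subseteq> S) * walsh A \<eta>)"
      using A by (intro sum.cong refl cube_mean_swapped_walsh[OF \<eta>]) auto
    then show "(\<Sum>i\<in>A. cube_mean n (\<lambda>\<epsilon>. override_on \<eta> \<epsilon> S i * (override_on \<epsilon> \<eta> S i * walsh A (override_on \<epsilon> \<eta> S)))) *\<^sub>R walsh_coeff n f A
      = (\<Sum>i\<in>A. of_bool (i \<notin> S \<and> A - {i} \<subseteq> S) * walsh A \<eta>) *\<^sub>R walsh_coeff n f A" by (rule arg_cong)
  qed
  finally show ?thesis by (simp add: sum_distrib_right)
qed

section \<open>Jensen's inequality for powers\<close>

lemma convex_on_powr:
  assumes "1 \<le> p"
  shows "convex_on {0::real..} (\<lambda>x. x powr p)"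
proof (rule convex_onI)
  fix t x y :: real
  assume t: "0 < t" "t < 1" and xy: "x \<in> {0..}" "y \<in> {0..}"
  have pow: "s powr p \<le> s" if "0 < s" "s < 1" for s :: real
    using powr_mono'[of 1 p s] assms that by simp
  show "((1 - t) *\<^sub>R x + t *\<^sub>R y) powr p \<le> (1 - t) * x powr p + t * y powr p"
  proof (cases "x = 0 \<or> y = 0")
    case True
    have "((1 - t) * x) powr p \<le> (1 - t) * x powr p" "(t * y) powr p \<le> t * y powr p"
      using pow[of t] pow[of "1 - t"] t xy by (simp_all add: powr_mult mult_right_mono)
    then show ?thesis using True assms by auto
  next
    case False
    then have "x > 0" "y > 0" using xy by auto
    then show ?thesis using convex_onD[OF powr_convex[OF assms], of t x y] t by simp
  qed
qed (simp add: convex_real_interval)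

lemma jensen_powr:
  assumes "finite I" "1 \<le> p" "\<And>i. i \<in> I \<Longrightarrow> 0 \<le> a i" "\<And>i. i \<in> I \<Longrightarrow> 0 \<le> x i" "sum a I = (1::real)"
  shows "(\<Sum>i\<in>I. a i * x i) powr p \<le> (\<Sum>i\<in>I. a i * x i powr p)"
proof -
  have "I \<noteq> {}" using assms(5) by auto
  then show ?thesis
    using convex_on_sum[OF assms(1) _ convex_on_powr[OF assms(2)] assms(5) assms(3), of x] assms(4)
    by simp
qed

section \<open>Norm of the swap operators\<close>

lemma sum_cube_mult:
  assumes \<eta>: "\<eta> \<in> cube n"
  shows "(\<Sum>\<epsilon>\<in>cube n. g (restrict (\<lambda>i. \<epsilon> i * \<eta> i) {1..n})) = (\<Sum>\<epsilon>\<in>cube n. g \<epsilon>)"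
proof -
  let ?M = "\<lambda>\<epsilon>. restrict (\<lambda>i. \<epsilon> i * \<eta> i) {1..n}"
  have M: "?M (?M \<epsilon>) = \<epsilon>" if \<epsilon>: "\<epsilon> \<in> cube n" for \<epsilon>
  proof (rule ext)
    fix i
    show "?M (?M \<epsilon>) i = \<epsilon> i"
      using \<epsilon> cube_square[OF \<eta>, of i] by (cases "i \<in> {1..n}") (auto simp: cube_def mult.assoc)
  qed
  show ?thesis
    by (rule sum.reindex_bij_witness[of _ ?M ?M]) (simp_all only: M cube_mult[OF _ \<eta>])
qed

lemma gradient_norm_powr:
  assumes "1 \<le> p"
  shows "gradient_norm n p f powr p
    = cube_mean n (\<lambda>\<delta>. cube_mean n (\<lambda>\<epsilon>. norm (\<Sum>i = 1..n. \<delta> i *\<^sub>R partial_deriv i f \<epsilon>) powr p))"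
  using assms by (simp add: gradient_norm_def Lp_norm_def powr_powr cube_mean_nonneg)

lemma cube_mean_cube_mean:
  "cube_mean n (\<lambda>\<eta>. cube_mean n (\<Psi> \<eta>)) = (\<Sum>(\<eta>, \<epsilon>)\<in>cube n \<times> cube n. \<Psi> \<eta> \<epsilon>) / (2 ^ n * 2 ^ n :: real)"
  unfolding cube_mean_def sum.cartesian_product[symmetric]
  by (simp add: sum_divide_distrib divide_divide_eq_left)

text \<open>
  The exchange of coordinates is an involution of the set of pairs of points, so the pair \<open>(y, z)\<close> can be averaged over the
  whole product; then \<open>z\<close> can be replaced by \<open>z y\<close>.
\<close>

lemma cube_mean_swapped_deriv:
  assumes "1 \<le> p"
  shows "cube_mean n (\<lambda>\<eta>. cube_mean n (\<lambda>\<epsilon>.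
      norm (swapped_deriv n f (override_on \<epsilon> \<eta> S) (override_on \<eta> \<epsilon> S)) powr p)) = gradient_norm n p f powr p"
proof -
  define \<Phi> where "\<Phi> y z = norm (swapped_deriv n f y z) powr p" for y z
  let ?T = "\<lambda>(\<eta>, \<epsilon>). (override_on \<epsilon> \<eta> S, override_on \<eta> \<epsilon> S)"
  have "(\<Sum>(\<eta>, \<epsilon>)\<in>cube n \<times> cube n. \<Phi> (override_on \<epsilon> \<eta> S) (override_on \<eta> \<epsilon> S))
      = (\<Sum>(y, z)\<in>cube n \<times> cube n. \<Phi> y z)"
  proof (rule sum.reindex_bij_witness[of _ ?T ?T])
    have TT: "override_on (override_on \<eta> \<epsilon> S) (override_on \<epsilon> \<eta> S) S = \<eta>" for \<eta> \<epsilon> :: "nat \<Rightarrow> real"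
      by (auto simp: override_on_def)
    show "?T (?T x) = x" "?T (?T x) = x" for x :: "(nat \<Rightarrow> real) \<times> (nat \<Rightarrow> real)"
      by (auto simp: TT split: prod.split)
  qed (auto simp: cube_override)
  also have "\<dots> = (\<Sum>y\<in>cube n. \<Sum>z\<in>cube n. \<Phi> y z)"
    by (simp add: sum.cartesian_product)
  also have "\<dots> = (\<Sum>y\<in>cube n. \<Sum>z\<in>cube n. norm (\<Sum>i = 1..n. z i *\<^sub>R partial_deriv i f y) powr p)"
  proof (rule sum.cong[OF refl])
    fix y assume y: "y \<in> cube n"
    have "norm (\<Sum>i = 1..n. restrict (\<lambda>i. z i * y i) {1..n} i *\<^sub>R partial_deriv i f y) powr p = \<Phi> y z" for z
      unfolding \<Phi>_def swapped_deriv_def by (intro arg_cong[where f = "\<lambda>x. norm x powr p"] sum.cong) auto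
    then show "(\<Sum>z\<in>cube n. \<Phi> y z) = (\<Sum>z\<in>cube n. norm (\<Sum>i = 1..n. z i *\<^sub>R partial_deriv i f y) powr p)"
      using sum_cube_mult[OF y, of "\<lambda>z. norm (\<Sum>i = 1..n. z i *\<^sub>R partial_deriv i f y) powr p"] by (simp only:)
  qed
  also have "\<dots> = (\<Sum>z\<in>cube n. \<Sum>y\<in>cube n. norm (\<Sum>i = 1..n. z i *\<^sub>R partial_deriv i f y) powr p)"
    by (rule sum.swap)
  finally show ?thesis
    unfolding gradient_norm_powr[OF assms] cube_mean_cube_mean \<Phi>_def by (simp add: sum.cartesian_product)
qed

section \<open>Mixing the swap operators\<close>

text \<open>
  The weight of \<open>S\<close> if \<open>y\<close> has density \<open>(1 - P(y)) / y\<close> and every coordinate belongs to \<open>S\<close> with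
  probability \<open>1 - y\<close>.
\<close>

definition swap_weight :: "nat \<Rightarrow> nat \<Rightarrow> nat set \<Rightarrow> real" where
  "swap_weight n d S = integral {0..1} (\<lambda>y. poly (legendre_quotient d) y * ((1 - y) ^ card S * y ^ (n - card S)))"

lemma legendre_quotient_nonneg:
  assumes "0 \<le> y" "y \<le> 1"
  shows "0 \<le> poly (legendre_quotient m) y"
proof (cases "y = 0")
  case True
  have "poly (legendre_quotient m) 0 = (if m = 0 then 0 else - legendre_coeff m 1)"
    by (auto simp: legendre_quotient_def poly_0_coeff_0 coeff_sum coeff_monom)
  then show ?thesis by (auto simp: True legendre_coeff_def mult_nonneg_nonpos)
next
  case False
  have "0 \<le> y * poly (legendre_quotient m) y" using legendre_le_1[OF assms] by (simp add: poly_legendre_quotient)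
  then show ?thesis using assms False by (simp add: zero_le_mult_iff)
qed

lemma swap_weight_integrable:
  "(\<lambda>y. poly (legendre_quotient d) y * ((1 - y) ^ k * y ^ l)) integrable_on {0..1::real}"
  by (intro integrable_continuous_real continuous_intros)

lemma swap_weight_nonneg: "0 \<le> swap_weight n d S"
  unfolding swap_weight_def by (intro integral_nonneg swap_weight_integrable) (simp add: legendre_quotient_nonneg)

text \<open>
  Reduces a weighted sum over \<open>S\<close> to an integral over \<open>y\<close> of an expectation in a product measure.
\<close>

lemma sum_swap_weight_eq:
  assumes "\<And>y. 0 \<le> y \<Longrightarrow> y \<le> 1 \<Longrightarrow> (\<Sum>S\<in>Pow {1..n}. c S * ((1 - y) ^ card S * y ^ (n - card S))) = w y"
  shows "(\<Sum>S\<in>Pow {1..n}. c S * swap_weight n d S) = integral {0..1} (\<lambda>y. poly (legendre_quotient d) y * w y)"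
proof -
  have "(\<Sum>S\<in>Pow {1..n}. c S * swap_weight n d S)
      = integral {0..1} (\<lambda>y. \<Sum>S\<in>Pow {1..n}. c S * (poly (legendre_quotient d) y * ((1 - y) ^ card S * y ^ (n - card S))))"
    unfolding swap_weight_def
    by (subst integral_sum) (auto intro!: integrable_continuous_real continuous_intros)
  also have "\<dots> = integral {0..1} (\<lambda>y. poly (legendre_quotient d) y * w y)"
  proof (rule integral_cong)
    fix y :: real assume "y \<in> {0..1}"
    then show "(\<Sum>S\<in>Pow {1..n}. c S * (poly (legendre_quotient d) y * ((1 - y) ^ card S * y ^ (n - card S)))) = poly (legendre_quotient d) y * w y"
      by (subst assms[symmetric]) (auto simp: sum_distrib_left mult_ac)
  qed
  finally show ?thesis .
qed

text \<open>
  The expectation of a product \<open>\<Prod>j. (if j \<in> S then a\<^sub>j else b\<^sub>j)\<close> factorises.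
\<close>

lemma product_measure_sum:
  fixes a b :: "nat \<Rightarrow> real"
  shows "(\<Sum>S\<in>Pow {1..n}. ((\<Prod>j\<in>S. a j) * (\<Prod>j\<in>{1..n} - S. b j)) * ((1 - y) ^ card S * y ^ (n - card S)))
     = (\<Prod>j\<in>{1..n}. a j * (1 - y) + b j * y)"
proof -
  have "(\<Sum>S\<in>Pow {1..n}. ((\<Prod>j\<in>S. a j) * (\<Prod>j\<in>{1..n} - S. b j)) * ((1 - y) ^ card S * y ^ (n - card S)))
      = (\<Sum>S\<in>Pow {1..n}. (\<Prod>j\<in>S. a j * (1 - y)) * (\<Prod>j\<in>{1..n} - S. b j * y))"
  proof (intro sum.cong refl)
    fix S assume "S \<in> Pow {1..n}"
    then have "card ({1..n} - S) = n - card S" by (subst card_Diff_subset) (auto intro: finite_subset)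
    then show "((\<Prod>j\<in>S. a j) * (\<Prod>j\<in>{1..n} - S. b j)) * ((1 - y) ^ card S * y ^ (n - card S))
       = (\<Prod>j\<in>S. a j * (1 - y)) * (\<Prod>j\<in>{1..n} - S. b j * y)"
      by (simp add: prod.distrib)
  qed
  then show ?thesis by (simp add: prod_add)
qed

lemma sum_swap_weight: "(\<Sum>S\<in>Pow {1..n}. swap_weight n d S) = 2 * harm d"
  using sum_swap_weight_eq[where n = n and c = "\<lambda>_. 1" and w = "\<lambda>_. 1" and d = d] product_measure_sum[where a = "\<lambda>_. 1" and b = "\<lambda>_. 1" and n = n]
  by (simp add: integral_legendre_quotient)

text \<open>
  For each of the \<open>k = card A\<close> elements \<open>i\<close>, the probability of the pattern \<open>S \<inter> A = A - {i}\<close> is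
  \<open>y (1 - y)\<^sup>k\<^sup>-\<^sup>1\<close>. The factor \<open>y\<close> cancels the denominator of the density, the Legendre polynomial
  drops out by orthogonality as \<open>k - 1 < d\<close>, and \<open>\<integral> (1 - y)\<^sup>k\<^sup>-\<^sup>1 dy = 1 / k\<close>.
\<close>

lemma sum_swap_weight_pattern:
  assumes A: "A \<subseteq> {1..n}" "A \<noteq> {}" "card A \<le> d"
  shows "(\<Sum>S\<in>Pow {1..n}. (\<Sum>i\<in>A. of_bool (i \<notin> S \<and> A - {i} \<subseteq> S)) * swap_weight n d S) = 1"
proof -
  have fin: "finite A" using A finite_subset by blast
  have pos: "card A > 0" using A fin by (simp add: card_gt_0_iff)
  have one: "(\<Sum>S\<in>Pow {1..n}. of_bool (i \<notin> S \<and> A - {i} \<subseteq> S) * swap_weight n d S) = 1 / real (card A)" if i: "i \<in> A" for i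
  proof -
    \<comment> \<open>The indicator of the pattern as a product: \<open>a\<close> forbids \<open>i \<in> S\<close>, and \<open>b\<close> forbids leaving out an element of \<open>A - {i}\<close>.\<close>
    define a b :: "nat \<Rightarrow> real"
      where "a j = of_bool (j \<noteq> i)" and "b j = of_bool (j \<notin> A - {i})" for j
    have ab: "of_bool (i \<notin> S \<and> A - {i} \<subseteq> S) = (\<Prod>j\<in>S. a j) * (\<Prod>j\<in>{1..n} - S. b j)" if "S \<in> Pow {1..n}" for S
    proof -
      have "finite S" using that finite_subset by auto
      moreover have "A - {i} \<subseteq> S \<longleftrightarrow> (\<forall>j\<in>{1..n} - S. j \<notin> A - {i})" using A by blast
      ultimately show ?thesis by (auto simp: a_def b_def prod_zero_iff intro!: prod.neutral)
    qed
    have "(\<Prod>j\<in>{1..n}. a j * (1 - y) + b j * y) = y * (1 - y) ^ (card A - 1)" for y :: real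
    proof -
      have "(\<Prod>j\<in>{1..n}. a j * (1 - y) + b j * y) = (\<Prod>j\<in>A. a j * (1 - y) + b j * y)"
        using A i by (intro prod.mono_neutral_right) (auto simp: a_def b_def)
      also have "\<dots> = (a i * (1 - y) + b i * y) * (\<Prod>j\<in>A - {i}. a j * (1 - y) + b j * y)"
        using fin i by (rule prod.remove)
      also have "(\<Prod>j\<in>A - {i}. a j * (1 - y) + b j * y) = (\<Prod>j\<in>A - {i}. 1 - y)"
        by (rule prod.cong) (auto simp: a_def b_def)
      finally show ?thesis using fin i by (simp add: a_def b_def)
    qed
    then have "(\<Sum>S\<in>Pow {1..n}. of_bool (i \<notin> S \<and> A - {i} \<subseteq> S) * swap_weight n d S)
      = integral {0..1} (\<lambda>y. poly (legendre_quotient d) y * (y * (1 - y) ^ (card A - 1)))"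
      by (intro sum_swap_weight_eq) (simp only: ab product_measure_sum cong: sum.cong)
    also have "\<dots> = integral {0..1} (\<lambda>y. (1 - y) ^ (card A - 1) - poly (legendre d) y * (1 - y) ^ (card A - 1))"
    proof (rule integral_cong)
      fix y :: real
      have "poly (legendre_quotient d) y * (y * (1 - y) ^ (card A - 1)) = (y * poly (legendre_quotient d) y) * (1 - y) ^ (card A - 1)"
        by simp
      then show "poly (legendre_quotient d) y * (y * (1 - y) ^ (card A - 1))
        = (1 - y) ^ (card A - 1) - poly (legendre d) y * (1 - y) ^ (card A - 1)"
        unfolding poly_legendre_quotient by (simp add: algebra_simps)
    qed
    also have "\<dots> = integral {0..1} (\<lambda>y::real. (1 - y) ^ (card A - 1)) - integral {0..1} (\<lambda>y. poly (legendre d) y * (1 - y) ^ (card A - 1))"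
      by (rule integral_diff; intro integrable_continuous_real continuous_intros)
    also have "integral {0..1} (\<lambda>y. poly (legendre d) y * (1 - y) ^ (card A - 1)) = 0"
      using A pos by (intro legendre_orthogonal) simp
    also have "integral {0..1} (\<lambda>y::real. (1 - y) ^ (card A - 1)) = 1 / real (card A)"
    proof (rule integral_unique)
      have "((\<lambda>y::real. (1 - y) ^ (card A - 1)) has_integral (- ((1 - 1) ^ card A) / real (card A) - (- ((1 - 0) ^ card A) / real (card A)))) {0..1}"
      proof (rule fundamental_theorem_of_calculus)
        fix y :: real
        have "((\<lambda>y. - ((1 - y) ^ card A) / real (card A)) has_real_derivative (1 - y) ^ (card A - 1)) (at y within {0..1})"
          using pos by (auto intro!: derivative_eq_intros)
        then show "((\<lambda>y. - ((1 - y) ^ card A) / real (card A)) has_vector_derivative (1 - y) ^ (card A - 1)) (at y within {0..1})"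
          by (simp add: has_real_derivative_iff_has_vector_derivative)
      qed simp
      then show "((\<lambda>y::real. (1 - y) ^ (card A - 1)) has_integral 1 / real (card A)) {0..1}"
        using pos by (simp add: power_0_left)
    qed
    finally show ?thesis by simp
  qed
  have "(\<Sum>S\<in>Pow {1..n}. (\<Sum>i\<in>A. of_bool (i \<notin> S \<and> A - {i} \<subseteq> S)) * swap_weight n d S)
      = (\<Sum>i\<in>A. \<Sum>S\<in>Pow {1..n}. of_bool (i \<notin> S \<and> A - {i} \<subseteq> S) * swap_weight n d S)"
    by (subst sum.swap) (simp add: sum_distrib_right)
  also have "\<dots> = (\<Sum>i\<in>A. 1 / real (card A))" by (rule sum.cong[OF refl one])
  also have "\<dots> = 1" using pos by simp
  finally show ?thesis .
qed

lemma centred_eq_sum_swap_op: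
  assumes f: "degree_at_most n d f" and \<eta>: "\<eta> \<in> cube n"
  shows "f \<eta> - cube_mean n f = (\<Sum>S\<in>Pow {1..n}. swap_weight n d S *\<^sub>R swap_op n S f \<eta>)"
proof -
  have "(\<Sum>S\<in>Pow {1..n}. swap_weight n d S *\<^sub>R swap_op n S f \<eta>)
      = (\<Sum>A\<in>Pow {1..n}. \<Sum>S\<in>Pow {1..n}. (((\<Sum>i\<in>A. of_bool (i \<notin> S \<and> A - {i} \<subseteq> S)) * swap_weight n d S) * walsh A \<eta>) *\<^sub>R walsh_coeff n f A)"
    unfolding swap_op_expansion[OF \<eta>] scaleR_sum_right by (subst sum.swap) (simp add: mult_ac)
  also have "\<dots> = (\<Sum>A\<in>Pow {1..n}. ((\<Sum>S\<in>Pow {1..n}. (\<Sum>i\<in>A. of_bool (i \<notin> S \<and> A - {i} \<subseteq> S)) * swap_weight n d S) * walsh A \<eta>) *\<^sub>R walsh_coeff n f A)"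
    by (simp only: scaleR_sum_left sum_distrib_right)
  also have "\<dots> = (\<Sum>A\<in>Pow {1..n}. (if A = {} then 0 else walsh A \<eta> *\<^sub>R walsh_coeff n f A))"
  proof (intro sum.cong refl)
    fix A assume "A \<in> Pow {1..n}"
    then consider "A = {}" | "A \<subseteq> {1..n}" "A \<noteq> {}" "card A \<le> d" | "walsh_coeff n f A = 0"
      using f unfolding degree_at_most_def by (cases "A = {}"; cases "card A \<le> d") auto
    then show "((\<Sum>S\<in>Pow {1..n}. (\<Sum>i\<in>A. of_bool (i \<notin> S \<and> A - {i} \<subseteq> S)) * swap_weight n d S) * walsh A \<eta>) *\<^sub>R walsh_coeff n f A
        = (if A = {} then 0 else walsh A \<eta> *\<^sub>R walsh_coeff n f A)"
    proof cases
      case 2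
      then show ?thesis by (simp only: sum_swap_weight_pattern[OF 2] if_False mult_1_left)
    qed simp_all
  qed
  also have "\<dots> = (\<Sum>A\<in>Pow {1..n}. walsh A \<eta> *\<^sub>R walsh_coeff n f A) - walsh {} \<eta> *\<^sub>R walsh_coeff n f {}"
    by (subst (2) sum.remove[of _ "{}"], simp, simp, subst sum.remove[of _ "{}"]) (auto intro!: sum.cong)
  also have "\<dots> = f \<eta> - cube_mean n f"
    by (subst walsh_expansion[OF \<eta>, symmetric]) (simp add: walsh_def walsh_coeff_def)
  finally show ?thesis ..
qed

text \<open>
  One application of Jensen's inequality to the normalised product of the weights \<open>swap_weight n d S\<close> with
  the uniform measure for \<open>\<epsilon>\<close> bounds \<open>\<parallel>f - E f\<parallel>\<^sup>p\<close> pointwise; averaging over \<open>\<eta>\<close> turns every term into the \<open>p\<close>-th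
  power of the gradient norm.
\<close>

theorem Pisier_inequality_degree:
  fixes f :: "(nat \<Rightarrow> real) \<Rightarrow> 'a::real_normed_vector"
  assumes d: "1 \<le> d" and p: "1 \<le> p" and f: "degree_at_most n d f"
  shows "Lp_norm n p (\<lambda>\<epsilon>. f \<epsilon> - cube_mean n f) \<le> 2 * harm d * gradient_norm n p f"
proof -
  define W :: real where "W = 2 * harm d"
  have W: "W > 0" using d by (simp add: W_def)
  define G where "G = gradient_norm n p f"
  have G: "G \<ge> 0" by (simp add: G_def gradient_norm_def)
  let ?I = "Pow {1..n} \<times> cube n"
  define a where "a = (\<lambda>(S, \<epsilon> :: nat \<Rightarrow> real). swap_weight n d S / (W * 2 ^ n))"
  define h where "h \<eta> = (\<lambda>(S, \<epsilon>). norm (swapped_deriv n f (override_on \<epsilon> \<eta> S) (override_on \<eta> \<epsilon> S)))" for \<eta>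
  have sw: "(\<Sum>S\<in>Pow {1..n}. swap_weight n d S) = W" by (simp only: sum_swap_weight W_def)
  have sum_I: "(\<Sum>x\<in>?I. a x * g x) = (\<Sum>S\<in>Pow {1..n}. swap_weight n d S / W * cube_mean n (\<lambda>\<epsilon>. g (S, \<epsilon>)))" for g
    by (simp add: a_def sum.cartesian_product' cube_mean_def sum_distrib_left sum_divide_distrib)
  have suma: "(\<Sum>x\<in>?I. a x) = 1"
    using W sum_I[of "\<lambda>_. 1"] by (simp add: sum_divide_distrib[symmetric] sw del: One_nat_def)
  have a: "a x \<ge> 0" for x using W by (cases x) (simp add: a_def swap_weight_nonneg)
  have "norm (f \<eta> - cube_mean n f) powr p \<le> W powr p * (\<Sum>x\<in>?I. a x * h \<eta> x powr p)" if \<eta>: "\<eta> \<in> cube n" for \<eta>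
  proof -
    have "norm (f \<eta> - cube_mean n f) \<le> (\<Sum>S\<in>Pow {1..n}. swap_weight n d S * norm (swap_op n S f \<eta>))"
      unfolding centred_eq_sum_swap_op[OF f \<eta>]
      by (intro order.trans[OF norm_sum]) (simp add: swap_weight_nonneg)
    also have "\<dots> \<le> (\<Sum>S\<in>Pow {1..n}. swap_weight n d S * cube_mean n (\<lambda>\<epsilon>. h \<eta> (S, \<epsilon>)))"
    proof (intro sum_mono mult_left_mono swap_weight_nonneg)
      show "norm (swap_op n S f \<eta>) \<le> cube_mean n (\<lambda>\<epsilon>. h \<eta> (S, \<epsilon>))" for S
        unfolding swap_op_def h_def cube_mean_def by (simp add: divide_right_mono norm_sum)
    qed
    also have "\<dots> = W * (\<Sum>x\<in>?I. a x * h \<eta> x)"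
      unfolding sum_I using W by (simp add: sum_distrib_left)
    finally have "norm (f \<eta> - cube_mean n f) powr p \<le> (W * (\<Sum>x\<in>?I. a x * h \<eta> x)) powr p"
      using p by (intro powr_mono2) auto
    also have "\<dots> = W powr p * (\<Sum>x\<in>?I. a x * h \<eta> x) powr p"
      using W by (intro powr_mult)
    also have "\<dots> \<le> W powr p * (\<Sum>x\<in>?I. a x * h \<eta> x powr p)"
      using a suma p by (intro mult_left_mono jensen_powr) (auto simp: h_def)
    finally show ?thesis .
  qed
  then have "cube_mean n (\<lambda>\<eta>. norm (f \<eta> - cube_mean n f) powr p)
      \<le> cube_mean n (\<lambda>\<eta>. W powr p * (\<Sum>x\<in>?I. a x * h \<eta> x powr p))"
    by (rule cube_mean_mono)
  also have "\<dots> = W powr p * (\<Sum>x\<in>?I. a x * cube_mean n (\<lambda>\<eta>. h \<eta> x powr p))"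
    by (simp only: cube_mean_mult cube_mean_sum)
  also have "(\<Sum>x\<in>?I. a x * cube_mean n (\<lambda>\<eta>. h \<eta> x powr p))
      = (\<Sum>S\<in>Pow {1..n}. swap_weight n d S / W * cube_mean n (\<lambda>\<epsilon>. cube_mean n (\<lambda>\<eta>. h \<eta> (S, \<epsilon>) powr p)))"
    by (rule sum_I)
  also have "\<dots> = (\<Sum>S\<in>Pow {1..n}. swap_weight n d S / W * G powr p)"
  proof (intro sum.cong refl arg_cong2[where f = "(*)"])
    fix S
    have "cube_mean n (\<lambda>\<epsilon>. cube_mean n (\<lambda>\<eta>. h \<eta> (S, \<epsilon>) powr p)) = cube_mean n (\<lambda>\<eta>. cube_mean n (\<lambda>\<epsilon>. h \<eta> (S, \<epsilon>) powr p))"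
      unfolding cube_mean_def by (subst scaleR_sum_right, subst sum.swap) (simp add: sum_divide_distrib)
    then show "cube_mean n (\<lambda>\<epsilon>. cube_mean n (\<lambda>\<eta>. h \<eta> (S, \<epsilon>) powr p)) = G powr p"
      using cube_mean_swapped_deriv[OF p, of n f S] by (simp add: h_def G_def)
  qed
  also have "\<dots> = G powr p"
    using W by (simp add: sum_distrib_right[symmetric] sum_divide_distrib[symmetric] sw del: One_nat_def)
  finally have "cube_mean n (\<lambda>\<eta>. norm (f \<eta> - cube_mean n f) powr p) \<le> (W * G) powr p"
    using W G by (simp add: powr_mult)
  then have "Lp_norm n p (\<lambda>\<epsilon>. f \<epsilon> - cube_mean n f) \<le> ((W * G) powr p) powr (1 / p)"
    unfolding Lp_norm_def using p by (intro powr_mono2 cube_mean_nonneg) auto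
  also have "\<dots> = W * G" using W G p by (simp add: powr_powr)
  finally show ?thesis by (simp add: W_def G_def)
qed

section \<open>The logarithm of the number of minus signs\<close>

definition minus_count :: "nat \<Rightarrow> (nat \<Rightarrow> real) \<Rightarrow> nat" where
  "minus_count d \<epsilon> = card {i \<in> {1..d}. \<epsilon> i = -1}"

definition log_count :: "nat \<Rightarrow> (nat \<Rightarrow> real) \<Rightarrow> real" where
  "log_count d \<epsilon> = ln (sqrt (real d) + real (minus_count d \<epsilon>))"

text \<open>
  All translates \<open>g(\<epsilon> \<eta>)\<close> of \<open>g = log_count d\<close>, listed as a sequence through an enumeration of the points \<open>\<eta>\<close> of the
  cube. The supremum norm then takes the maximum over \<open>\<eta>\<close>.
\<close>

definition translates :: "nat \<Rightarrow> nat \<Rightarrow> (nat \<Rightarrow> real) \<Rightarrow> linfty" where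
  "translates n d \<epsilon> = Bcontfun (\<lambda>j. complex_of_real (log_count d (\<lambda>i. \<epsilon> i * from_nat_into (cube n) j i)))"

lemma cube_nonempty: "cube n \<noteq> {}"
  unfolding cube_def by (simp add: PiE_eq_empty_iff)

lemma from_nat_into_cube: "from_nat_into (cube n) j \<in> cube n"
  using from_nat_into[OF cube_nonempty] .

lemma cube_enumerated: "\<eta> \<in> cube n \<Longrightarrow> \<exists>j. from_nat_into (cube n) j = \<eta>"
  using range_from_nat_into[OF cube_nonempty countable_finite[OF finite_cube]] by (metis imageE)

lemma minus_count_le: "minus_count d \<epsilon> \<le> d"
proof -
  have "card {i \<in> {1..d}. \<epsilon> i = -1} \<le> card {1..d}" by (rule card_mono) auto
  then show ?thesis by (simp add: minus_count_def)
qed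

lemma log_count_cong: "(\<And>i. i \<in> {1..d} \<Longrightarrow> \<epsilon> i = \<eta> i) \<Longrightarrow> log_count d \<epsilon> = log_count d \<eta>"
proof -
  assume "\<And>i. i \<in> {1..d} \<Longrightarrow> \<epsilon> i = \<eta> i"
  then have "{i \<in> {1..d}. \<epsilon> i = -1} = {i \<in> {1..d}. \<eta> i = -1}" by auto
  then show ?thesis by (simp only: log_count_def minus_count_def)
qed

lemma apply_translates:
  assumes "1 \<le> d"
  shows "apply_bcontfun (translates n d \<epsilon>) j = complex_of_real (log_count d (\<lambda>i. \<epsilon> i * from_nat_into (cube n) j i))"
proof -
  have "norm (complex_of_real (log_count d \<xi>)) \<le> ln (sqrt (real d) + real d)" for \<xi>
  proof -
    have "1 \<le> sqrt (real d)" using assms by simp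
    moreover have "real (minus_count d \<xi>) \<le> real d" by (simp add: minus_count_le)
    ultimately have "0 \<le> log_count d \<xi>" "log_count d \<xi> \<le> ln (sqrt (real d) + real d)"
      using \<open>1 \<le> sqrt (real d)\<close> unfolding log_count_def by (auto intro!: ln_ge_zero ln_mono simp del: real_sqrt_ge_1_iff)
    then show ?thesis by simp
  qed
  then have "(\<lambda>j. complex_of_real (log_count d (\<lambda>i. \<epsilon> i * from_nat_into (cube n) j i))) \<in> bcontfun"
    by (intro bcontfun_normI) auto
  then show ?thesis by (simp add: translates_def Bcontfun_inverse)
qed

lemma cube_mean_odd:
  assumes i: "i \<in> {1..n}" and odd: "\<And>\<epsilon>. \<epsilon> \<in> cube n \<Longrightarrow> g (\<epsilon>(i := - \<epsilon> i)) = - g \<epsilon>"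
  shows "cube_mean n g = 0"
proof -
  have "(\<Sum>\<epsilon>\<in>cube n. g \<epsilon>) = (\<Sum>\<epsilon>\<in>cube n. g (\<epsilon>(i := - \<epsilon> i)))"
    by (rule sum.reindex_bij_witness[of _ "\<lambda>\<epsilon>. \<epsilon>(i := - \<epsilon> i)" "\<lambda>\<epsilon>. \<epsilon>(i := - \<epsilon> i)"]) (use i cube_flip in auto)
  also have "\<dots> = - (\<Sum>\<epsilon>\<in>cube n. g \<epsilon>)" by (simp add: odd sum_negf)
  finally have "(\<Sum>\<epsilon>\<in>cube n. g \<epsilon>) = 0" by (simp add: eq_neg_iff_add_eq_0 flip: scaleR_2)
  then show ?thesis by (simp add: cube_mean_def)
qed

lemma degree_at_most_junta:
  assumes "\<And>i \<epsilon>. i > d \<Longrightarrow> f (\<epsilon>(i := - \<epsilon> i)) = f \<epsilon>"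
  shows "degree_at_most n d f"
  unfolding degree_at_most_def walsh_coeff_def
proof (intro allI impI)
  fix A assume A: "A \<subseteq> {1..n}" "d < card A"
  then have fin: "finite A" using finite_subset by blast
  have "\<not> A \<subseteq> {1..d}" using A card_mono[of "{1..d}" A] by auto
  then obtain i where i: "i \<in> A" "i > d" "i \<in> {1..n}" using A by fastforce
  show "cube_mean n (\<lambda>\<delta>. walsh A \<delta> *\<^sub>R f \<delta>) = 0"
    by (rule cube_mean_odd[OF i(3)]) (simp add: walsh_flip fin i assms)
qed

lemma degree_translates: "degree_at_most n d (translates n d)"
proof (rule degree_at_most_junta)
  fix i \<epsilon> assume "i > d"
  then have "log_count d (\<lambda>k. (\<epsilon>(i := - \<epsilon> i)) k * from_nat_into (cube n) j k)
      = log_count d (\<lambda>k. \<epsilon> k * from_nat_into (cube n) j k)" for j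
    by (intro log_count_cong) auto
  then show "translates n d (\<epsilon>(i := - \<epsilon> i)) = translates n d \<epsilon>" by (simp add: translates_def)
qed

lemma ln_diff_le: "0 < a \<Longrightarrow> ln (a + 1) - ln a \<le> 1 / (a::real)"
  using ln_le_minus_one[of "(a + 1) / a"] by (simp add: ln_div field_simps)

text \<open>
  Let \<open>K\<close> be the set of coordinates \<open>-1\<close> and \<open>k\<close> its size. The partial derivative is \<open>\<alpha>\<close> on \<open>K\<close>
  and \<open>-\<beta>\<close> on the other coordinates up to \<open>d\<close>, so the sum is \<open>(\<alpha> + \<beta>) \<Sum>\<^sub>K \<delta> - \<beta> \<Sum>\<^sub>i\<^sub>\<le>\<^sub>d \<delta>\<^sub>i\<close>. Both
  \<open>\<alpha> k\<close> and \<open>\<beta> k\<close> are at most \<open>1/2\<close>, and \<open>\<beta> \<le> 1 / (2 \<surd>d)\<close>.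
\<close>

lemma log_count_gradient:
  fixes \<xi> \<delta> :: "nat \<Rightarrow> real"
  assumes d: "1 \<le> d" "d \<le> n" and \<xi>: "\<And>i. i \<in> {1..n} \<Longrightarrow> \<xi> i = -1 \<or> \<xi> i = 1"
    and \<delta>: "\<And>i. i \<in> {1..n} \<Longrightarrow> \<delta> i = -1 \<or> \<delta> i = 1"
  shows "\<bar>\<Sum>i=1..n. \<delta> i * partial_deriv i (log_count d) \<xi>\<bar> \<le> 1 + \<bar>\<Sum>i=1..d. \<delta> i\<bar> / sqrt (real d) / 2"
proof -
  define K where "K = {i \<in> {1..d}. \<xi> i = -1}"
  define k where "k = real (card K)"
  define s where "s = sqrt (real d)"
  have s: "s \<ge> 1" using d by (simp add: s_def)
  have K: "finite K" "K \<subseteq> {1..d}" by (auto simp: K_def)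
  define \<alpha> \<beta> where "\<alpha> = (ln (s + k) - ln (s + (k - 1))) / 2" and "\<beta> = (ln (s + (k + 1)) - ln (s + k)) / 2"
  have now: "log_count d \<xi> = ln (s + k)"
    by (simp add: log_count_def minus_count_def s_def k_def K_def)
  have in_K: "partial_deriv i (log_count d) \<xi> = \<alpha>" if i: "i \<in> K" for i
  proof -
    have "{j \<in> {1..d}. (\<xi>(i := - \<xi> i)) j = -1} = K - {i}" using i by (auto simp: K_def)
    then have "real (minus_count d (\<xi>(i := - \<xi> i))) = k - 1"
      using i K card_gt_0_iff[of K] by (auto simp: minus_count_def k_def of_nat_diff)
    then show ?thesis unfolding partial_deriv_def now \<alpha>_def by (simp add: log_count_def s_def)
  qed
  have off_K: "partial_deriv i (log_count d) \<xi> = - \<beta>" if i: "i \<in> {1..d} - K" for i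
  proof -
    have "\<xi> i = 1" using i \<xi>[of i] d by (auto simp: K_def)
    then have "{j \<in> {1..d}. (\<xi>(i := - \<xi> i)) j = -1} = insert i K" using i by (auto simp: K_def)
    then have "real (minus_count d (\<xi>(i := - \<xi> i))) = k + 1"
      using i K by (simp add: minus_count_def k_def)
    then show ?thesis unfolding partial_deriv_def now \<beta>_def by (simp add: log_count_def s_def field_simps)
  qed
  have beyond: "partial_deriv i (log_count d) \<xi> = 0" if "i > d" for i
  proof -
    have "log_count d (\<xi>(i := - \<xi> i)) = log_count d \<xi>" using that by (intro log_count_cong) auto
    then show ?thesis by (simp add: partial_deriv_def)
  qed
  have "(\<Sum>i=1..n. \<delta> i * partial_deriv i (log_count d) \<xi>) = (\<Sum>i=1..d. \<delta> i * partial_deriv i (log_count d) \<xi>)"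
    using d by (intro sum.mono_neutral_right) (auto simp: beyond)
  also have "\<dots> = (\<Sum>i\<in>{1..d} - K. \<delta> i * partial_deriv i (log_count d) \<xi>) + (\<Sum>i\<in>K. \<delta> i * partial_deriv i (log_count d) \<xi>)"
    using K by (intro sum.subset_diff) auto
  also have "\<dots> = - \<beta> * (\<Sum>i\<in>{1..d} - K. \<delta> i) + \<alpha> * (\<Sum>i\<in>K. \<delta> i)"
    by (simp add: in_K off_K sum_distrib_left mult.commute sum_negf)
  also have "(\<Sum>i\<in>{1..d} - K. \<delta> i) = (\<Sum>i=1..d. \<delta> i) - (\<Sum>i\<in>K. \<delta> i)"
    using K by (simp add: sum_diff)
  finally have eq: "(\<Sum>i=1..n. \<delta> i * partial_deriv i (log_count d) \<xi>) = (\<alpha> + \<beta>) * (\<Sum>i\<in>K. \<delta> i) - \<beta> * (\<Sum>i=1..d. \<delta> i)"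
    by (simp add: algebra_simps)
  have k0: "k \<ge> 0" by (simp add: k_def)
  have sumK: "\<bar>\<Sum>i\<in>K. \<delta> i\<bar> \<le> k"
  proof -
    have "\<bar>\<delta> i\<bar> \<le> 1" if "i \<in> K" for i
    proof -
      have "i \<in> {1..n}" using that K d by fastforce
      then show ?thesis using \<delta>[of i] by auto
    qed
    then have "(\<Sum>i\<in>K. \<bar>\<delta> i\<bar>) \<le> k"
      using sum_bounded_above[of K "\<lambda>i. \<bar>\<delta> i\<bar>" 1] by (simp add: k_def)
    then show ?thesis using sum_abs order.trans by blast
  qed
  have \<beta>0: "\<beta> \<ge> 0" using s k0 by (simp add: \<beta>_def)
  have \<beta>k: "\<beta> * 2 * (s + k) \<le> 1"
    using ln_diff_le[of "s + k"] s k0 by (simp add: \<beta>_def field_simps add.assoc)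
  have \<beta>1: "\<beta> * k \<le> 1 / 2" using \<beta>k mult_nonneg_nonneg[OF \<beta>0, of s] s by (simp add: algebra_simps)
  have \<beta>2: "\<beta> \<le> 1 / s / 2"
    using \<beta>k mult_nonneg_nonneg[OF \<beta>0 k0] s by (simp add: field_simps)
  have \<alpha>: "\<alpha> * k \<le> 1 / 2 \<and> (k = 0 \<or> 0 \<le> \<alpha>)"
  proof (cases "k = 0")
    case False
    then have k1: "k \<ge> 1" by (simp add: k_def Suc_leI card_gt_0_iff)
    have "\<alpha> \<ge> 0" using s k1 by (simp add: \<alpha>_def)
    moreover have "\<alpha> * 2 * (s + (k - 1)) \<le> 1"
      using ln_diff_le[of "s + (k - 1)"] s k1 by (simp add: \<alpha>_def field_simps)
    ultimately show ?thesis using mult_nonneg_nonneg[of \<alpha> "s - 1"] s by (simp add: algebra_simps)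
  qed simp
  have "\<bar>(\<alpha> + \<beta>) * (\<Sum>i\<in>K. \<delta> i)\<bar> \<le> (\<alpha> + \<beta>) * k"
  proof (cases "k = 0")
    case True
    then show ?thesis using sumK by simp
  next
    case False
    then show ?thesis using \<alpha> \<beta>0 sumK by (simp add: abs_mult mult_left_mono)
  qed
  also have "\<dots> \<le> 1" using \<alpha> \<beta>1 by (simp add: distrib_right)
  finally have 1: "\<bar>(\<alpha> + \<beta>) * (\<Sum>i\<in>K. \<delta> i)\<bar> \<le> 1" .
  have "\<bar>\<beta> * (\<Sum>i=1..d. \<delta> i)\<bar> \<le> 1 / s / 2 * \<bar>\<Sum>i=1..d. \<delta> i\<bar>"
    unfolding abs_mult using \<beta>0 \<beta>2 by (intro mult_right_mono) auto
  also have "\<dots> = \<bar>\<Sum>i=1..d. \<delta> i\<bar> / s / 2" by simp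
  finally show ?thesis using 1 unfolding eq s_def by linarith
qed

lemma apply_bcontfun_sum: "apply_bcontfun (\<Sum>i\<in>I. f i) x = (\<Sum>i\<in>I. apply_bcontfun (f i) x)"
  by (induction I rule: infinite_finite_induct) (simp_all add: zero_bcontfun.rep_eq plus_bcontfun.rep_eq)

lemma translates_gradient:
  assumes d: "1 \<le> d" "d \<le> n" and \<epsilon>: "\<epsilon> \<in> cube n" and \<delta>: "\<delta> \<in> cube n"
  shows "norm (\<Sum>i=1..n. \<delta> i *\<^sub>R partial_deriv i (translates n d) \<epsilon>) \<le> 1 + \<bar>\<Sum>i=1..d. \<delta> i\<bar> / sqrt (real d) / 2"
proof (rule norm_bound)
  fix j
  define \<eta> where "\<eta> = from_nat_into (cube n) j"
  define \<xi> where "\<xi> = (\<lambda>i. \<epsilon> i * \<eta> i)"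
  have \<eta>: "\<eta> \<in> cube n" by (simp add: \<eta>_def from_nat_into_cube)
  have flip: "(\<lambda>k. (\<epsilon>(i := - \<epsilon> i)) k * \<eta> k) = \<xi>(i := - \<xi> i)" for i by (auto simp: \<xi>_def)
  have "apply_bcontfun (partial_deriv i (translates n d) \<epsilon>) j = complex_of_real (partial_deriv i (log_count d) \<xi>)" for i
    unfolding partial_deriv_def
    by (simp add: apply_translates[OF d(1)] flip scaleR_conv_of_real flip: \<eta>_def \<xi>_def del: fun_upd_apply)
  then have "apply_bcontfun (\<Sum>i=1..n. \<delta> i *\<^sub>R partial_deriv i (translates n d) \<epsilon>) j
      = complex_of_real (\<Sum>i=1..n. \<delta> i * partial_deriv i (log_count d) \<xi>)"
    by (simp add: apply_bcontfun_sum scaleR_conv_of_real)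
  moreover have "\<xi> i = -1 \<or> \<xi> i = 1" if "i \<in> {1..n}" for i
    using cube_nth[OF \<epsilon> that] cube_nth[OF \<eta> that] by (auto simp: \<xi>_def)
  ultimately show "norm (apply_bcontfun (\<Sum>i=1..n. \<delta> i *\<^sub>R partial_deriv i (translates n d) \<epsilon>) j)
      \<le> 1 + \<bar>\<Sum>i=1..d. \<delta> i\<bar> / sqrt (real d) / 2"
    using log_count_gradient[OF d, of \<xi> \<delta>] cube_nth[OF \<delta>] by (simp only: norm_of_real real_norm_def)
qed

lemma exp_minus_plus_exp_le: "0 \<le> x \<Longrightarrow> x \<le> 1 \<Longrightarrow> exp (- x) + exp x \<le> 2 * exp (x\<^sup>2)" for x :: real
proof -
  assume x: "0 \<le> x" "x \<le> 1"
  have "1 \<le> (1 - x + x\<^sup>2) * (1 + x)" using x by (simp add: algebra_simps power2_eq_square)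
  also have "\<dots> \<le> (1 - x + x\<^sup>2) * exp x"
    using x by (intro mult_left_mono exp_ge_add_one_self) (simp add: add_nonneg_nonneg)
  finally have "exp (- x) \<le> 1 - x + x\<^sup>2" by (simp add: exp_minus field_simps)
  moreover have "exp x \<le> 1 + x + x\<^sup>2" using x by (rule exp_bound)
  moreover have "1 + x\<^sup>2 \<le> exp (x\<^sup>2)" by (rule exp_ge_add_one_self)
  ultimately show ?thesis by linarith
qed

text \<open>
  The normalised sum has moment generating function \<open>(cosh (1 / \<surd>d))\<^sup>d\<close> at \<open>\<plusminus>1\<close>, which stays bounded in \<open>d\<close>. This
  controls all \<open>p\<close>-th moments at once.
\<close>

lemma cube_mean_exp_abs_sum:
  assumes d: "1 \<le> d" "d \<le> n"
  shows "cube_mean n (\<lambda>\<delta>. exp (\<bar>\<Sum>i=1..d. \<delta> i\<bar> / sqrt (real d))) \<le> 2 * exp 1"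
proof -
  define x where "x = 1 / sqrt (real d)"
  have x: "0 \<le> x" "x \<le> 1" using d by (auto simp: x_def)
  have mgf: "cube_mean n (\<lambda>\<delta>. exp (t * (\<Sum>i=1..d. \<delta> i))) \<le> exp 1" if t: "\<bar>t\<bar> = x" for t
  proof -
    define h where "h i s = (if i \<le> d then exp (t * s) else 1)" for i :: nat and s
    have "exp (t * (\<Sum>i=1..d. \<delta> i)) = (\<Prod>i\<in>{1..n}. h i (\<delta> i))" for \<delta>
    proof -
      have "exp (t * (\<Sum>i=1..d. \<delta> i)) = (\<Prod>i\<in>{1..d}. h i (\<delta> i))"
        by (simp add: sum_distrib_left exp_sum h_def)
      also have "\<dots> = (\<Prod>i\<in>{1..n}. h i (\<delta> i))"
        using d by (intro prod.mono_neutral_left) (auto simp: h_def)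
      finally show ?thesis .
    qed
    then have "cube_mean n (\<lambda>\<delta>. exp (t * (\<Sum>i=1..d. \<delta> i))) = (\<Prod>i\<in>{1..n}. (h i (-1) + h i 1) / 2)"
      by (simp only: cube_mean_prod)
    also have "\<dots> = (\<Prod>i\<in>{1..d}. (h i (-1) + h i 1) / 2)"
      using d by (intro prod.mono_neutral_right) (auto simp: h_def)
    also have "\<dots> = ((exp (- t) + exp t) / 2) ^ d"
      by (simp add: h_def)
    also have "(exp (- t) + exp t) / 2 = (exp (- x) + exp x) / 2"
      using t by (cases "t \<ge> 0") (auto simp: abs_if split: if_splits)
    also have "\<dots> ^ d \<le> exp (x\<^sup>2) ^ d"
      using exp_minus_plus_exp_le[OF x] by (intro power_mono) auto
    also have "\<dots> = exp 1" using d by (simp add: x_def power_divide flip: exp_of_nat_mult)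
    finally show ?thesis .
  qed
  have "cube_mean n (\<lambda>\<delta>. exp (\<bar>\<Sum>i=1..d. \<delta> i\<bar> / sqrt (real d)))
     \<le> cube_mean n (\<lambda>\<delta>. exp (x * (\<Sum>i=1..d. \<delta> i)) + exp ((- x) * (\<Sum>i=1..d. \<delta> i)))"
  proof (rule cube_mean_mono)
    fix \<delta> :: "nat \<Rightarrow> real"
    have "\<bar>s\<bar> / sqrt (real d) = x * s \<or> \<bar>s\<bar> / sqrt (real d) = - x * s" for s
      by (cases "s \<ge> 0") (auto simp: x_def)
    then show "exp (\<bar>\<Sum>i=1..d. \<delta> i\<bar> / sqrt (real d)) \<le> exp (x * (\<Sum>i=1..d. \<delta> i)) + exp ((- x) * (\<Sum>i=1..d. \<delta> i))"
      by (smt (verit) exp_gt_zero)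
  qed
  also have "\<dots> \<le> 2 * exp 1"
    unfolding cube_mean_add using mgf[of x] mgf[of "- x"] x by simp
  finally show ?thesis .
qed

lemma powr_le_exp:
  assumes "1 \<le> p" "0 \<le> (x::real)"
  shows "(1 + x / 2) powr p \<le> p powr p * exp x"
proof -
  have "1 + x / 2 \<le> p * (1 + x / p)" using assms by (simp add: distrib_left)
  also have "\<dots> \<le> p * exp (x / p)" using assms by (intro mult_left_mono exp_ge_add_one_self) auto
  finally have "(1 + x / 2) powr p \<le> (p * exp (x / p)) powr p" using assms by (intro powr_mono2) auto
  also have "\<dots> = p powr p * exp x" using assms by (simp add: powr_mult exp_powr_real)
  finally show ?thesis .
qed

lemma gradient_norm_translates:
  assumes d: "1 \<le> d" "d \<le> n" and p: "1 \<le> p"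
  shows "gradient_norm n p (translates n d) \<le> 6 * p"
proof -
  define G where "G = gradient_norm n p (translates n d)"
  have G: "G \<ge> 0" by (simp add: G_def gradient_norm_def)
  let ?X = "\<lambda>\<delta>. \<bar>\<Sum>i=1..d. \<delta> i\<bar> / sqrt (real d)"
  have "G powr p \<le> cube_mean n (\<lambda>\<delta>. cube_mean n (\<lambda>\<epsilon>. p powr p * exp (?X \<delta>)))"
    unfolding G_def gradient_norm_powr[OF p]
  proof (intro cube_mean_mono)
    fix \<delta> \<epsilon> assume \<delta>: "\<delta> \<in> cube n" and \<epsilon>: "\<epsilon> \<in> cube n"
    have "norm (\<Sum>i = 1..n. \<delta> i *\<^sub>R partial_deriv i (translates n d) \<epsilon>) powr p \<le> (1 + ?X \<delta> / 2) powr p"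
      using p by (intro powr_mono2 translates_gradient d \<delta> \<epsilon>) auto
    also have "\<dots> \<le> p powr p * exp (?X \<delta>)" using p by (intro powr_le_exp) auto
    finally show "norm (\<Sum>i = 1..n. \<delta> i *\<^sub>R partial_deriv i (translates n d) \<epsilon>) powr p \<le> p powr p * exp (?X \<delta>)" .
  qed
  also have "\<dots> = p powr p * cube_mean n (\<lambda>\<delta>. exp (?X \<delta>))" by (simp add: cube_mean_mult)
  also have "\<dots> \<le> p powr p * (2 * exp 1)" by (intro mult_left_mono cube_mean_exp_abs_sum d) simp
  also have "\<dots> \<le> p powr p * 6" using exp_le by (intro mult_left_mono) auto
  also have "\<dots> \<le> p powr p * 6 powr p" using p powr_mono[of 1 p "6::real"] by (intro mult_left_mono) auto
  also have "\<dots> = (6 * p) powr p" using p by (simp add: powr_mult)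
  finally have "\<not> 6 * p < G" using powr_less_mono2[of p "6 * p" G] p by auto
  then show ?thesis by (simp add: G_def)
qed

text \<open>
  The mean of every coordinate of the sequence is the same number \<open>m\<close>, since translation preserves the uniform
  measure. The translates by \<open>\<epsilon>\<close> and \<open>-\<epsilon>\<close> take the smallest and the largest value of \<open>log_count d\<close> at \<open>\<epsilon>\<close>, and one of the two is at
  distance at least half their difference from \<open>m\<close>.
\<close>

lemma translates_deviation:
  assumes d: "1 \<le> d" "d \<le> n" and \<epsilon>: "\<epsilon> \<in> cube n"
  shows "ln (1 + sqrt (real d)) / 2 \<le> norm (translates n d \<epsilon> - cube_mean n (translates n d))"
proof -
  define m where "m = cube_mean n (log_count d)"
  have coord: "\<bar>log_count d (\<lambda>i. \<epsilon> i * \<eta> i) - m\<bar> \<le> norm (translates n d \<epsilon> - cube_mean n (translates n d))"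
    if \<eta>: "\<eta> \<in> cube n" for \<eta>
  proof -
    obtain j where j: "from_nat_into (cube n) j = \<eta>" using cube_enumerated[OF \<eta>] by blast
    have "log_count d (\<lambda>i. \<epsilon> i * \<eta> i) = log_count d (restrict (\<lambda>i. \<epsilon> i * \<eta> i) {1..n})" for \<epsilon>
      using d by (intro log_count_cong) auto
    then have "m = cube_mean n (\<lambda>\<epsilon>. log_count d (\<lambda>i. \<epsilon> i * \<eta> i))"
      using sum_cube_mult[OF \<eta>, of "log_count d"] by (simp add: m_def cube_mean_def)
    then have "apply_bcontfun (translates n d \<epsilon> - cube_mean n (translates n d)) j
        = complex_of_real (log_count d (\<lambda>i. \<epsilon> i * \<eta> i) - m)"
      by (simp add: cube_mean_def apply_bcontfun_sum apply_translates[OF d(1)] j scaleR_conv_of_real)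
    then show ?thesis
      using norm_bounded[of "translates n d \<epsilon> - cube_mean n (translates n d)" j]
      by (simp only: norm_of_real real_norm_def)
  qed
  \<comment> \<open>The antipode of \<open>\<epsilon>\<close>, cut off to be a point of the cube.\<close>
  have neg: "restrict (\<lambda>i. - \<epsilon> i) {1..n} \<in> cube n"
    unfolding cube_def using cube_nth[OF \<epsilon>] by (intro restrict_PiE_iff[THEN iffD2] ballI) force
  have sq: "\<epsilon> i * \<epsilon> i = 1" if "i \<in> {1..d}" for i using cube_square[OF \<epsilon>, of i] that d by auto
  have "minus_count d (\<lambda>i. \<epsilon> i * \<epsilon> i) = 0"
    by (simp add: minus_count_def) (use sq in force)
  then have lo: "log_count d (\<lambda>i. \<epsilon> i * \<epsilon> i) = ln (sqrt (real d))" by (simp add: log_count_def)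
  have "{i \<in> {1..d}. \<epsilon> i * restrict (\<lambda>i. - \<epsilon> i) {1..n} i = -1} = {1..d}"
    using sq d by auto
  then have hi: "log_count d (\<lambda>i. \<epsilon> i * restrict (\<lambda>i. - \<epsilon> i) {1..n} i) = ln (sqrt (real d) + real d)"
    by (simp add: log_count_def minus_count_def)
  have "sqrt (real d) + real d = sqrt (real d) * (1 + sqrt (real d))" by (simp add: algebra_simps)
  then have "ln (sqrt (real d) + real d) = ln (sqrt (real d)) + ln (1 + sqrt (real d))"
    using d by (simp add: ln_mult_pos add_pos_nonneg)
  then show ?thesis using coord[OF \<epsilon>] coord[OF neg] unfolding lo hi by linarith
qed

lemma Lp_norm_ge:
  assumes "1 \<le> p" "0 \<le> a" "\<And>\<epsilon>. \<epsilon> \<in> cube n \<Longrightarrow> a \<le> norm (f \<epsilon>)"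
  shows "a \<le> Lp_norm n p f"
proof -
  have "a = (cube_mean n (\<lambda>_. a powr p)) powr (1 / p)" using assms by (simp add: powr_powr)
  also have "\<dots> \<le> Lp_norm n p f"
    unfolding Lp_norm_def using assms by (intro powr_mono2 cube_mean_mono cube_mean_nonneg) auto
  finally show ?thesis .
qed

section \<open>The inequality and its sharpness\<close>

theorem theorem3:
  shows "(\<forall>(n::nat) (d::nat) (p::real) (f :: (nat \<Rightarrow> real) \<Rightarrow> 'a::complex_banach).
            1 \<le> d \<and> d \<le> n \<and> 1 \<le> p \<and> degree_at_most n d f \<longrightarrow>
              Lp_norm n p (\<lambda>\<epsilon>. f \<epsilon> - cube_mean n f) \<le> 3 * (ln (real d) + 1) * gradient_norm n p f)
       \<and> (\<forall>p::real. 1 \<le> p \<longrightarrow>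
            (\<exists>c>0. \<forall>(n::nat) (d::nat). 1 \<le> d \<and> d \<le> n \<longrightarrow>
              (\<exists>f :: (nat \<Rightarrow> real) \<Rightarrow> linfty. degree_at_most n d f \<and> gradient_norm n p f > 0 \<and>
                 Lp_norm n p (\<lambda>\<epsilon>. f \<epsilon> - cube_mean n f) \<ge> c * ln (real d) * gradient_norm n p f)))"
proof (intro conjI allI impI)
  fix n d :: nat and p :: real and f :: "(nat \<Rightarrow> real) \<Rightarrow> 'a"
  assume "1 \<le> d \<and> d \<le> n \<and> 1 \<le> p \<and> degree_at_most n d f"
  then have d: "1 \<le> d" and p: "1 \<le> p" and f: "degree_at_most n d f" by auto
  have "2 * harm d \<le> 2 * (1 + ln (real d))" using harm_le[of d] d by simp
  also have "\<dots> \<le> 3 * (ln (real d) + 1)" using d by simp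
  finally have "2 * harm d * gradient_norm n p f \<le> 3 * (ln (real d) + 1) * gradient_norm n p f"
    by (intro mult_right_mono) (auto simp: gradient_norm_def)
  then show "Lp_norm n p (\<lambda>\<epsilon>. f \<epsilon> - cube_mean n f) \<le> 3 * (ln (real d) + 1) * gradient_norm n p f"
    using Pisier_inequality_degree[OF d p f] by linarith
next
  fix p :: real assume p: "1 \<le> p"
  show "\<exists>c>0. \<forall>(n::nat) (d::nat). 1 \<le> d \<and> d \<le> n \<longrightarrow>
              (\<exists>f :: (nat \<Rightarrow> real) \<Rightarrow> linfty. degree_at_most n d f \<and> gradient_norm n p f > 0 \<and>
                 Lp_norm n p (\<lambda>\<epsilon>. f \<epsilon> - cube_mean n f) \<ge> c * ln (real d) * gradient_norm n p f)"
  proof (intro exI[of _ "1 / (24 * p)"] conjI allI impI)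
    show "0 < 1 / (24 * p)" using p by simp
    fix n d :: nat assume "1 \<le> d \<and> d \<le> n"
    then have d: "1 \<le> d" "d \<le> n" by auto
    let ?f = "translates n d"
    let ?G = "gradient_norm n p ?f" and ?L = "Lp_norm n p (\<lambda>\<epsilon>. ?f \<epsilon> - cube_mean n ?f)"
    have pos: "ln (1 + sqrt (real d)) > 0" using d by (intro ln_gt_zero) simp
    have dev: "ln (1 + sqrt (real d)) / 2 \<le> ?L"
      using pos by (intro Lp_norm_ge[OF p] translates_deviation d) auto
    \<comment> \<open>Positivity of the gradient norm follows from the upper bound: the function is not constant.\<close>
    have "0 < 2 * harm d * ?G"
      using Pisier_inequality_degree[OF d(1) p degree_translates[of n d]] dev pos by linarith
    moreover have "?G \<ge> 0" by (simp add: gradient_norm_def)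
    ultimately have G: "?G > 0" by (auto simp: zero_less_mult_iff)
    \<comment> \<open>The constant: \<open>1/(24 p)\<close> times the gradient bound \<open>6 p\<close> is \<open>1/4\<close>, and \<open>log d / 4 = log \<surd>d / 2\<close>.\<close>
    have "1 / (24 * p) * ln (real d) * ?G \<le> 1 / (24 * p) * ln (real d) * (6 * p)"
      using p d by (intro mult_left_mono gradient_norm_translates) auto
    also have "\<dots> = ln (real d) / 4" using p by simp
    also have "\<dots> = ln (sqrt (real d)) / 2" using d by (simp add: ln_sqrt)
    also have "\<dots> \<le> ln (1 + sqrt (real d)) / 2"
      using d ln_mono[of "sqrt (real d)" "1 + sqrt (real d)"] by simp
    also note dev
    finally show "\<exists>f :: (nat \<Rightarrow> real) \<Rightarrow> linfty. degree_at_most n d f \<and> gradient_norm n p f > 0 \<and>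
                 Lp_norm n p (\<lambda>\<epsilon>. f \<epsilon> - cube_mean n f) \<ge> 1 / (24 * p) * ln (real d) * gradient_norm n p f"
      using degree_translates G by blast
  qed
qed

end
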